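(* Suppose that each $f_i$ is $L$-smooth on $\Omega$ ($L>0$), i.e. $\|\nabla f_i(x)-\nabla f_i(y)\|\le L\|x-y\|$ for all $x,y\in\Omega$; that $f$ is $\mu$-strongly convex on $\Omega$ ($\mu>0$), i.e. $f(y)\ge f(x)+\langle y-x,\nabla f(x)\rangle+\frac\mu2\|y-x\|^2$ for all $x,y\in\Omega$; that $\mathcal G$ and $W$ are as in the context; and that there is a constant $R_s>0$ with $\|\mathbf{x}(t)-\mathbf{x}_*\|^2\le R_s$ for all $t\ge0$. Let $p\in(0,1]$ and $\alpha(t)=\frac{v}{(t+w)^p}$ with $v,w>0$ satisfying $$\alpha(0)=\frac{v}{w^p}\le\frac{2}{L+\mu}.$$ Let $\rho_1=\big(\frac{w+1}{w}\big)^{2p}$ and $\rho_2=\sup_{t\ge0}\beta^t/\alpha(t)^2$. Then: 1. If $p\in(0,1)$, then for all $t$ with $[t/2]+w-1>0$, $$\|\bar{\mathbf{x}}(t)-\mathbf{x}_*\|^2\le\frac{2e\rho_1(\rho_2G_3+G_4)v}{\mu}\big([t/2]+w-1\big)^{-p}+\mathcal{R}_1(t)+\mathcal{R}_2(t),$$ where $$\mathcal{R}_1(t)=e^{-\sum_{s=0}^{t-1}\frac{\mu v}{2(s+w)^p}}\|\bar{\mathbf{x}}(0)-\mathbf{x}_*\|^2,\qquad \mathcal{R}_2(t)=\rho_1(\rho_2G_3+G_4)v^2e^{-\frac{\mu vt}{4(t+w)^p}}\sum_{s=1}^{[t/2]-1}\frac{1}{(s+w)^{2p}}.$$ 2. If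 $p=1$ and $v>0$ is chosen such that $\mu v/2>1$, then for all $t$ with $t+w-1>0$, $$\|\bar{\mathbf{x}}(t)-\mathbf{x}_*\|^2\le\Big(\frac{w}{t+w}\Big)^{\mu v/2}\|\bar{\mathbf{x}}(0)-\mathbf{x}_*\|^2+\mathcal{R}_3(t),\qquad \mathcal{R}_3(t)=\frac{\rho_1}{(\mu v/2)-1}\Big(\frac{w+1}{w}\Big)^{\mu v/2}\frac{(\rho_2G_3+G_4)v^2}{t+w-1}.$$
   Context: Let $n,d\ge1$, let $\Omega\subset\mathbb{R}^d$ be a nonempty closed convex set, $f_i:\Omega\to\mathbb{R}$ ($1\le i\le n$) differentiable functions, and $f=\frac1n\sum_{i=1}^n f_i$. $\|\cdot\|$ is the Euclidean norm and $\mathcal{P}_\Omega[y]=\arg\min_{x\in\Omega}\|x-y\|$. $x_*$ denotes the unique minimizer of $f$ over $\Omega$, and $R_D^*:=\max_{1\le i\le n}\|\nabla f_i(x_* )\|^2$. $[s/2]$ is the integer part of $s/2$; empty sums are zero. Network: $\mathcal{G}=(\mathcal V,\mathcal E)$, $\mathcal V=\{1,\dots,n\}$, is a fixed (time-independent) connected undirected graph. The mixing matrix $W=[w_{ij}]$ has nonnegative entries, with $w_{ij}\ne0$ if $\{i,j\}\in\mathcal E$ and, for $i\neq j$, $w_{ij}=0$ if $\{i,j\}\notin\mathcal E$; $W$ is symmetric and doubly stochastic, $w_{ii}>0$ for all $i$, and $\mathrm{null}(I-W)=\mathrm{span}\{(1,\dots,1)^T\}$. $\beta\in[0,1)$ is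 the second largest magnitude of the eigenvalues of $W$. Decentralized projected gradient (DPG) iterates: given $x_i(0)\in\Omega$ and stepsizes $\alpha(t)>0$, $$x_i(t+1)=\mathcal{P}_\Omega\Big[\sum_{j=1}^n w_{ij}x_j(t)-\alpha(t)\nabla f_i(x_i(t))\Big],\qquad 1\le i\le n,\ t\ge0.$$ Put $\bar x(t)=\frac1n\sum_i x_i(t)$, $\mathbf{x}(t)=(x_1(t),\dots,x_n(t))$, $\bar{\mathbf{x}}(t)=(\bar x(t),\dots,\bar x(t))$, $\mathbf{x}_*=(x_*,\dots,x_* )$ in $\mathbb{R}^{dn}$. Constants: $c_1=\frac{3L^2}{1-\beta}$, $c_2=\frac{3nR_D^*}{1-\beta}$, $c_3=c_1+L^2$, $c_4=\frac{4L^2}{\mu}$, $$R_c=3(L^2R_s+nR_D^* )\cdot\sup_{s\ge0}\frac{\alpha(0)^2\beta^s+\alpha([s/2])^2}{\alpha(s)^2},$$ $$G_3=\big(c_3\alpha(0)^2+c_4\alpha(0)+\beta\big)R_s,\qquad G_4=\big(c_3\alpha(0)^2+c_4\alpha(0)+\beta\big)\frac{2R_c}{(1-\beta)^2}+c_1R_s+c_2.$$ *)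

theory Defs
  imports "HOL-Analysis.Analysis" "HOL-Library.Multiset"
begin

text \<open>
  The gradient is taken relative to the constraint set, since the functions are only given there.
  At points where the derivative within the set does not determine the gradient (for instance when
  the set has empty interior), any vector representing it is allowed.
\<close>

definition gradient_on :: "'a::real_inner set \<Rightarrow> ('a \<Rightarrow> real) \<Rightarrow> ('a \<Rightarrow> 'a) \<Rightarrow> bool" where
  "gradient_on S f g \<longleftrightarrow>
     (\<forall>x\<in>S. (f has_derivative (\<lambda>h. g x \<bullet> h)) (at x within S))"

definition strongly_convex_on ::
  "real \<Rightarrow> 'a::real_inner set \<Rightarrow> ('a \<Rightarrow> real) \<Rightarrow> ('a \<Rightarrow> 'a) \<Rightarrow> bool" where
  "strongly_convex_on \<mu> S f g \<longleftrightarrow>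
     (\<forall>x\<in>S. \<forall>y\<in>S. f y \<ge> f x + (y - x) \<bullet> g x + \<mu> / 2 * (norm (y - x))\<^sup>2)"

text \<open>
  The vertex set is the whole type; an undirected graph is given by its edges \<open>{i, j}\<close>.
  Loops are allowed: nothing below depends on them.
\<close>

definition undirected_graph :: "'n set set \<Rightarrow> bool" where
  "undirected_graph E \<longleftrightarrow> (\<forall>e\<in>E. \<exists>i j. e = {i, j})"

definition connected_graph :: "'n set set \<Rightarrow> bool" where
  "connected_graph E \<longleftrightarrow> (\<forall>i j. (i, j) \<in> {(k, l). {k, l} \<in> E}\<^sup>*)"

definition mixing_matrix :: "'n::finite set set \<Rightarrow> real ^ 'n ^ 'n \<Rightarrow> bool" where
  "mixing_matrix E W \<longleftrightarrow>
     (\<forall>i j. W $ i $ j \<ge> 0) \<and>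
     (\<forall>i j. {i, j} \<in> E \<longrightarrow> W $ i $ j \<noteq> 0) \<and>
     (\<forall>i j. i \<noteq> j \<longrightarrow> {i, j} \<notin> E \<longrightarrow> W $ i $ j = 0) \<and>
     transpose W = W \<and>
     (\<forall>i. (\<Sum>j\<in>UNIV. W $ i $ j) = 1) \<and>
     (\<forall>j. (\<Sum>i\<in>UNIV. W $ i $ j) = 1) \<and>
     (\<forall>i. W $ i $ i > 0) \<and>
     {y. (mat 1 - W) *v y = 0} = span {\<chi> i. 1}"

definition eigenspace :: "real ^ 'n ^ 'n::finite \<Rightarrow> real \<Rightarrow> (real ^ 'n) set" where
  "eigenspace A l = {y. A *v y = l *\<^sub>R y}"

definition eigenvalues :: "real ^ 'n ^ 'n::finite \<Rightarrow> real set" where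
  "eigenvalues A = {l. \<exists>y. y \<noteq> 0 \<and> A *v y = l *\<^sub>R y}"

text \<open>
  Real eigenvalues with geometric multiplicity. For symmetric matrices, the only ones considered,
  these are all the eigenvalues and the algebraic multiplicities agree.
\<close>

definition eigenvalue_mset :: "real ^ 'n ^ 'n::finite \<Rightarrow> real multiset" where
  "eigenvalue_mset A = (\<Sum>l\<in>eigenvalues A. replicate_mset (dim (eigenspace A l)) l)"

text \<open>A \<open>1 \<times> 1\<close> matrix has no second eigenvalue; the value is then 0 by convention.\<close>

definition second_eigenvalue_magnitude :: "real ^ 'n ^ 'n::finite \<Rightarrow> real" where
  "second_eigenvalue_magnitude A =
     (let ms = rev (sorted_list_of_multiset (image_mset abs (eigenvalue_mset A)))
      in if length ms \<ge> 2 then ms ! 1 else 0)"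

text \<open>
  The stacked vector of the agents' states lives in \<open>real ^ 'd ^ 'n\<close>, whose norm is the Euclidean
  norm of all \<open>d n\<close> coordinates.
\<close>

definition dpg_iterates ::
  "(real ^ 'd) set \<Rightarrow> real ^ 'n ^ 'n \<Rightarrow> ('n \<Rightarrow> real ^ 'd \<Rightarrow> real ^ 'd) \<Rightarrow> (nat \<Rightarrow> real) \<Rightarrow>
   (nat \<Rightarrow> real ^ 'd ^ 'n::finite) \<Rightarrow> bool" where
  "dpg_iterates \<Omega> W gradf \<alpha> x \<longleftrightarrow>
     (\<forall>i. x 0 $ i \<in> \<Omega>) \<and>
     (\<forall>t i. x (Suc t) $ i =
        closest_point \<Omega> ((\<Sum>j\<in>UNIV. W $ i $ j *\<^sub>R x t $ j) - \<alpha> t *\<^sub>R gradf i (x t $ i)))"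

definition agent_mean :: "real ^ 'd ^ 'n::finite \<Rightarrow> real ^ 'd" where
  "agent_mean y = (1 / real CARD('n)) *\<^sub>R (\<Sum>i\<in>UNIV. y $ i)"

definition stack :: "real ^ 'd \<Rightarrow> real ^ 'd ^ 'n::finite" where
  "stack z = (\<chi> i. z)"

end

theory Submission
  imports Defs "HOL-Real_Asymp.Real_Asymp"
begin

text \<open>
  Write \<open>B t\<close> for the consensus error, the squared distance of the stacked state from the stacked mean
  of the agents, and \<open>A t\<close> for the squared distance of the stacked mean from the stacked minimizer.
  By orthogonality \<open>A + B\<close> is the squared distance of the stacked state from the minimizer, and this
  is what makes the projection harmless: the mean of the projected states is not the projection of
  their mean, but the projection is nonexpansive on each agent, so one bounds \<open>A (t + 1)\<close> by
  \<open>A (t + 1) + B (t + 1)\<close>, removes the projection from the sum, and only then splits the unprojected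
  step into its mean and its deviation from the mean (\<open>distance_step\<close>).

  The deviation part is governed by the network. On vectors orthogonal to the constants the mixing
  matrix contracts by its second largest eigenvalue magnitude \<open>\<beta> < 1\<close>
  (\<open>mixing_matrix_contracts_mean_zero\<close>). The mean part is an ordinary gradient step for the
  average function, perturbed by the disagreement of the agents. It contracts because on a convex
  set the gradient of a smooth convex function is cocoercive (\<open>cocoercive_on_convex\<close>,
  \<open>gradient_step_contraction\<close>). Since the functions live only on the constraint set, the usual proof of
  cocoercivity, which evaluates the function at points outside that set, is applied to many short pieces
  of a segment in the relative interior. If the set has empty interior, the gradient is determined only
  up to vectors normal to the set; such vectors do not affect the projected step, so all gradients may
  be replaced by their tangential parts (\<open>dpg_iterates_tangential\<close>).

  Both parts together give, with \<open>c\<^sub>1\<close> to \<open>c\<^sub>4\<close> as in the theorem,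
  \<open>A (t + 1) \<le> (1 - \<mu> \<alpha> / 2) A + (c\<^sub>3 \<alpha>\<^sup>2 + c\<^sub>4 \<alpha> + \<beta>) B + c\<^sub>1 \<alpha>\<^sup>2 A + c\<^sub>2 \<alpha>\<^sup>2\<close>, where \<open>\<alpha>\<close> is the stepsize
  at time \<open>t\<close> (\<open>mean_error_step\<close>). The
  assumed bound on the iterates controls the gradients, hence \<open>B t\<close> is at most \<open>\<beta> ^ t R\<^sub>s\<close> plus a constant
  times the squared stepsize (\<open>consensus_recursion_bound\<close>), and \<open>\<beta> ^ t\<close> is itself at most
  \<open>\<rho>\<^sub>2\<close> times the squared stepsize. What remains is the scalar recursion
  \<open>A (t + 1) \<le> (1 - \<mu> \<alpha> / 2) A + (\<rho>\<^sub>2 G\<^sub>3 + G\<^sub>4) \<alpha>\<^sup>2\<close>, which is unrolled with \<open>1 - a \<le> exp (- a)\<close> and summed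
  separately for harmonic stepsizes (\<open>harmonic_stepsize_rate\<close>) and for slower
  ones (\<open>polynomial_stepsize_rate\<close>).
\<close>

section \<open>Spectral contraction of mixing matrices\<close>

text \<open>
  A unit vector \<open>y\<close> of the subspace at which \<open>norm (T y)\<close> is maximal, say equal to \<open>m\<close>, satisfies
  \<open>T (T y) = m\<^sup>2 y\<close>, since the norm of the difference turns out to be zero. As \<open>(T - m) (T + m)\<close> then
  annihilates \<open>y\<close>, either \<open>y\<close> is an eigenvector for \<open>- m\<close> or \<open>T y + m y\<close> is one for \<open>m\<close>.
\<close>

lemma self_adjoint_invariant_subspace_extremal_eigenvector:
  fixes T :: "'a::euclidean_space \<Rightarrow> 'a"
  assumes T: "linear T" and adj: "\<And>u v. T u \<bullet> v = u \<bullet> T v"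
    and V: "subspace V" and inv: "\<And>u. u \<in> V \<Longrightarrow> T u \<in> V" and ne: "V \<noteq> {0}"
  obtains v l where "v \<in> V" "v \<noteq> 0" "T v = l *\<^sub>R v" "\<And>u. u \<in> V \<Longrightarrow> norm (T u) \<le> \<bar>l\<bar> * norm u"
proof -
  have "compact (V \<inter> sphere 0 1)"
    using closed_subspace[OF V] by (simp add: closed_Int_compact)
  moreover obtain a where a: "a \<in> V" "a \<noteq> 0"
    using ne subspace_0[OF V] by auto
  have "a /\<^sub>R norm a \<in> V \<inter> sphere 0 1"
    using a subspace_scale[OF V] by simp
  ultimately obtain y where y: "y \<in> V \<inter> sphere 0 1"
    and max: "\<And>u. u \<in> V \<inter> sphere 0 1 \<Longrightarrow> norm (T u) \<le> norm (T y)"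
    using continuous_attains_sup[of "V \<inter> sphere 0 1" "\<lambda>u. norm (T u)"]
      linear_continuous_on[of T] T
    by (metis empty_iff linear_conv_bounded_linear continuous_on_norm)
  define m where "m = norm (T y)"
  have bound: "norm (T u) \<le> m * norm u" if "u \<in> V" for u
  proof (cases "u = 0")
    case False
    have "norm (T (u /\<^sub>R norm u)) \<le> m"
      using max[of "u /\<^sub>R norm u"] that False subspace_scale[OF V] by (simp add: m_def)
    then show ?thesis
      using False by (simp add: linear_scale[OF T] field_simps)
  qed (simp add: linear_0[OF T])
  have "y \<in> V" "norm y = 1" using y by auto
  then have "y \<bullet> y = 1" by (simp add: dot_square_norm)
  have "T y \<in> V" using \<open>y \<in> V\<close> by (rule inv)
  have "(norm (T (T y) - m\<^sup>2 *\<^sub>R y))\<^sup>2 = (norm (T (T y)))\<^sup>2 - 2 * m\<^sup>2 * (T (T y) \<bullet> y) + (m\<^sup>2)\<^sup>2"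
    using \<open>y \<bullet> y = 1\<close>
    unfolding power2_norm_eq_inner inner_diff_left inner_diff_right inner_scaleR_left inner_scaleR_right
    by (simp add: inner_commute[of y "T (T y)"] algebra_simps power2_eq_square)
  also have "T (T y) \<bullet> y = m\<^sup>2"
    by (simp add: adj m_def power2_norm_eq_inner)
  also have "(norm (T (T y)))\<^sup>2 \<le> (m * m)\<^sup>2"
    using bound[OF \<open>T y \<in> V\<close>] by (intro power_mono) (auto simp: m_def)
  finally have "(norm (T (T y) - m\<^sup>2 *\<^sub>R y))\<^sup>2 \<le> 0"
    by (simp add: power2_eq_square)
  then have "T (T y) - m\<^sup>2 *\<^sub>R y = 0"
    by simp
  then have TT: "T (T y) = (m * m) *\<^sub>R y"
    by (simp add: power2_eq_square)
  show thesis
  proof (cases "T y + m *\<^sub>R y = 0")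
    case True
    then have "T y = (- m) *\<^sub>R y" by (simp add: eq_neg_iff_add_eq_0)
    moreover have "y \<noteq> 0" using \<open>norm y = 1\<close> by auto
    ultimately show ?thesis
      using bound \<open>y \<in> V\<close> by (intro that[of y "- m"]) (simp_all add: m_def)
  next
    case False
    have "T (T y + m *\<^sub>R y) = m *\<^sub>R (T y + m *\<^sub>R y)"
      by (simp add: linear_add[OF T] linear_scale[OF T] TT algebra_simps)
    moreover have "T y + m *\<^sub>R y \<in> V"
      using \<open>T y \<in> V\<close> \<open>y \<in> V\<close> V by (simp add: subspace_add subspace_scale)
    ultimately show ?thesis
      using False bound by (intro that[of "T y + m *\<^sub>R y" m]) (simp_all add: m_def)
  qed
qed

lemma symmetric_matrix_inner:
  fixes A :: "real ^ 'n ^ 'n::finite"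
  assumes "transpose A = A"
  shows "(A *v u) \<bullet> v = u \<bullet> (A *v v)"
  using dot_lmul_matrix[of u A v] transpose_matrix_vector[of A u] assms by simp

text \<open>
  Eigenvectors for distinct eigenvalues are orthogonal, hence independent. Finiteness matters because the
  multiset of eigenvalues is a sum over the set of eigenvalues, and a sum over an infinite set is empty.
\<close>

lemma finite_eigenvalues_symmetric:
  fixes A :: "real ^ 'n ^ 'n::finite"
  assumes sym: "transpose A = A"
  shows "finite (eigenvalues A)"
proof -
  define e where "e = (\<lambda>l. SOME y. y \<noteq> 0 \<and> A *v y = l *\<^sub>R y)"
  have e: "e l \<noteq> 0" "A *v e l = l *\<^sub>R e l" if "l \<in> eigenvalues A" for l
    using someI_ex[of "\<lambda>y. y \<noteq> 0 \<and> A *v y = l *\<^sub>R y"] that by (auto simp: eigenvalues_def e_def)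
  have orth: "e k \<bullet> e l = 0" if "k \<in> eigenvalues A" "l \<in> eigenvalues A" "k \<noteq> l" for k l
  proof -
    have "k * (e k \<bullet> e l) = l * (e k \<bullet> e l)"
      using symmetric_matrix_inner[OF sym, of "e k" "e l"] e that by simp
    then show ?thesis using that by simp
  qed
  have "pairwise orthogonal (e ` eigenvalues A)"
    using orth by (auto simp: pairwise_def orthogonal_def)
  moreover have "0 \<notin> e ` eigenvalues A" using e by force
  ultimately have "finite (e ` eigenvalues A)"
    using pairwise_orthogonal_independent independent_bound by blast
  moreover have "inj_on e (eigenvalues A)"
    by (rule inj_onI) (metis e(1) orth inner_eq_zero_iff)
  ultimately show ?thesis using finite_imageD by blast
qed

lemma count_eigenvalue_mset:
  fixes A :: "real ^ 'n ^ 'n::finite"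
  assumes "transpose A = A"
  shows "count (eigenvalue_mset A) l = (if l \<in> eigenvalues A then dim (eigenspace A l) else 0)"
  using finite_eigenvalues_symmetric[OF assms]
  by (auto simp: eigenvalue_mset_def count_sum sum.delta)

lemma eigenspace_dim_pos:
  fixes A :: "real ^ 'n ^ 'n::finite"
  assumes "l \<in> eigenvalues A"
  shows "dim (eigenspace A l) > 0"
proof -
  obtain y where "y \<noteq> 0" "y \<in> eigenspace A l"
    using assms by (auto simp: eigenvalues_def eigenspace_def)
  then have "dim (eigenspace A l) \<noteq> 0"
    unfolding dim_eq_0 by blast
  then show ?thesis by (simp only: neq0_conv)
qed

text \<open>
  Counting the entries above a threshold describes the second largest entry without reference to the
  order in which the list is sorted.
\<close>

lemma second_largest_ge_iff:
  fixes xs :: "real list"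
  assumes "sorted (rev xs)"
  shows "2 \<le> length (filter (\<lambda>x. r \<le> x) xs) \<longleftrightarrow> 2 \<le> length xs \<and> r \<le> xs ! 1"
proof -
  consider "xs = []" | a where "xs = [a]" | a b ys where "xs = a # b # ys"
    by (metis list.exhaust)
  then show ?thesis
  proof cases
    case 3
    then have "a \<ge> b" "\<forall>y\<in>set ys. y \<le> b"
      using assms by (auto simp: sorted_append)
    moreover have "filter (\<lambda>x. r \<le> x) ys = []" if "\<not> r \<le> b"
      using that calculation by (auto simp: filter_empty_conv)
    ultimately show ?thesis
      using 3 by auto
  qed auto
qed

lemma second_eigenvalue_magnitude_ge_iff:
  fixes A :: "real ^ 'n ^ 'n::finite"
  assumes "r > 0"
  shows "r \<le> second_eigenvalue_magnitude A \<longleftrightarrow> 2 \<le> size {#l \<in># eigenvalue_mset A. r \<le> \<bar>l\<bar>#}"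
proof -
  define ms where "ms = rev (sorted_list_of_multiset (image_mset abs (eigenvalue_mset A)))"
  have "length (filter (\<lambda>x. r \<le> x) ms) = size {#x \<in># mset ms. r \<le> x#}"
    by (metis mset_filter size_mset)
  also have "\<dots> = size {#l \<in># eigenvalue_mset A. r \<le> \<bar>l\<bar>#}"
    by (simp add: ms_def filter_mset_image_mset)
  finally show ?thesis
    using second_largest_ge_iff[of ms r] assms
    by (auto simp: second_eigenvalue_magnitude_def Let_def ms_def)
qed

lemma second_eigenvalue_magnitude_nonneg: "0 \<le> second_eigenvalue_magnitude A"
proof -
  define ms where "ms = rev (sorted_list_of_multiset (image_mset abs (eigenvalue_mset A)))"
  have "\<forall>x\<in>set ms. 0 \<le> x"
    by (auto simp: ms_def)
  then have "0 \<le> (if 2 \<le> length ms then ms ! 1 else 0)"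
    by auto
  then show ?thesis
    by (simp only: second_eigenvalue_magnitude_def ms_def Let_def)
qed

text \<open>
  Gershgorin's argument in the row of a largest entry of an eigenvector: the eigenvalue lies within
  \<open>1 - W $ i $ i\<close> of \<open>W $ i $ i\<close>, and the positive diagonal keeps this interval away from \<open>- 1\<close>.
\<close>

lemma mixing_matrix_eigenvalue_range:
  assumes W: "mixing_matrix E W" and l: "l \<in> eigenvalues W"
  shows "- 1 < l" "l \<le> 1"
proof -
  obtain y where y: "y \<noteq> 0" "W *v y = l *\<^sub>R y"
    using l by (auto simp: eigenvalues_def)
  obtain i where i: "\<And>j. \<bar>y $ j\<bar> \<le> \<bar>y $ i\<bar>"
    using Max_in[of "range (\<lambda>j. \<bar>y $ j\<bar>)"] Max_ge[of "range (\<lambda>j. \<bar>y $ j\<bar>)"]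
    by (metis (no_types, lifting) finite_class.finite_UNIV finite_imageI image_iff image_is_empty UNIV_not_empty rangeI)
  have "y $ i \<noteq> 0"
    using y(1) i by (metis abs_le_zero_iff abs_zero vec_eq_iff zero_index)
  have nn: "\<And>j. W $ i $ j \<ge> 0" and row: "(\<Sum>j\<in>UNIV. W $ i $ j) = 1" and dg: "W $ i $ i > 0"
    using W by (auto simp: mixing_matrix_def)
  have "l * y $ i = (\<Sum>j\<in>UNIV. W $ i $ j * y $ j)"
    using arg_cong[OF y(2), of "\<lambda>z. z $ i"] by (simp add: matrix_vector_mult_def)
  then have "(l - W $ i $ i) * y $ i = (\<Sum>j\<in>UNIV - {i}. W $ i $ j * y $ j)"
    by (simp add: sum.remove[of UNIV i] algebra_simps)
  then have "\<bar>l - W $ i $ i\<bar> * \<bar>y $ i\<bar> = \<bar>\<Sum>j\<in>UNIV - {i}. W $ i $ j * y $ j\<bar>"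
    by (metis abs_mult)
  also have "\<dots> \<le> (\<Sum>j\<in>UNIV - {i}. W $ i $ j * \<bar>y $ i\<bar>)"
    using nn i by (intro order.trans[OF sum_abs] sum_mono) (simp add: abs_mult mult_left_mono)
  also have "\<dots> = (1 - W $ i $ i) * \<bar>y $ i\<bar>"
    using row by (simp add: sum_distrib_right[symmetric] sum.remove[of UNIV i])
  finally have "\<bar>l - W $ i $ i\<bar> \<le> 1 - W $ i $ i"
    using \<open>y $ i \<noteq> 0\<close> by simp
  then show "- 1 < l" "l \<le> 1" using dg by auto
qed

lemma mixing_matrix_eigenspace_1:
  assumes "mixing_matrix E W"
  shows "eigenspace W 1 = span {\<chi> i. 1}"
proof -
  have "(mat 1 - W) *v y = 0 \<longleftrightarrow> W *v y = 1 *\<^sub>R y" for y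
    by (auto simp: matrix_vector_mult_diff_rdistrib)
  then show ?thesis
    using assms by (simp add: mixing_matrix_def eigenspace_def)
qed

text \<open>
  Only the eigenvalue 1 has magnitude at least 1, and it is simple because the kernel of
  \<open>mat 1 - W\<close> is spanned by one vector.
\<close>

lemma second_eigenvalue_magnitude_mixing_less_1:
  assumes W: "mixing_matrix E W"
  shows "second_eigenvalue_magnitude W < 1"
proof (rule ccontr)
  assume "\<not> ?thesis"
  then have "2 \<le> size {#l \<in># eigenvalue_mset W. 1 \<le> \<bar>l\<bar>#}"
    using second_eigenvalue_magnitude_ge_iff[of 1 W] by simp
  moreover have sym: "transpose W = W" using W by (simp add: mixing_matrix_def)
  have "l = 1" if "l \<in># eigenvalue_mset W" "1 \<le> \<bar>l\<bar>" for l
  proof -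
    have "l \<in> eigenvalues W"
      using that count_eigenvalue_mset[OF sym] by (metis count_greater_zero_iff less_irrefl)
    then show ?thesis
      using mixing_matrix_eigenvalue_range[OF W] that(2) by fastforce
  qed
  then have "{#l \<in># eigenvalue_mset W. 1 \<le> \<bar>l\<bar>#} = {#l \<in># eigenvalue_mset W. l = 1#}"
    by (intro filter_mset_cong) auto
  moreover have "size {#l \<in># eigenvalue_mset W. l = 1#} = count (eigenvalue_mset W) 1"
    by (simp add: filter_eq_replicate_mset)
  moreover have "\<dots> \<le> 1"
    using mixing_matrix_eigenspace_1[OF W] dim_le_card'[of "{(\<chi> i. 1)}"]
    by (simp add: count_eigenvalue_mset[OF sym])
  ultimately show False by simp
qed

text \<open>
  Vectors with zero mean form an invariant subspace, on which the norm of \<open>W\<close> is attained at an eigenvector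
  with some eigenvalue \<open>l\<close>. This \<open>l\<close> differs from 1, as the eigenvectors for 1 are the constant vectors.
  Hence 1 and \<open>l\<close> are two members of the multiset of eigenvalues with magnitude at least \<open>\<bar>l\<bar>\<close>, and so
  \<open>\<bar>l\<bar>\<close> is at most the second largest magnitude.
\<close>

lemma mixing_matrix_contracts_mean_zero:
  fixes u :: "real ^ 'n::finite"
  assumes W: "mixing_matrix E W" and u: "(\<Sum>i\<in>UNIV. u $ i) = 0"
  shows "norm (W *v u) \<le> second_eigenvalue_magnitude W * norm u"
proof -
  define V where "V = {u :: real ^ 'n. (\<Sum>i\<in>UNIV. u $ i) = 0}"
  have sym: "transpose W = W" and col: "\<And>j. (\<Sum>i\<in>UNIV. W $ i $ j) = 1"
    and row: "\<And>i. (\<Sum>j\<in>UNIV. W $ i $ j) = 1"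
    using W by (auto simp: mixing_matrix_def)
  have V: "subspace V"
    by (auto simp: subspace_def V_def sum.distrib sum_distrib_left[symmetric])
  have inv: "W *v u \<in> V" if "u \<in> V" for u
  proof -
    have "(\<Sum>i\<in>UNIV. (W *v u) $ i) = (\<Sum>j\<in>UNIV. (\<Sum>i\<in>UNIV. W $ i $ j) * u $ j)"
      unfolding matrix_vector_mult_def vec_lambda_beta sum_distrib_right by (rule sum.swap)
    then show ?thesis
      using that by (simp add: V_def col)
  qed
  show ?thesis
  proof (cases "V = {0}")
    case True
    moreover have "u \<in> V" using u by (simp add: V_def)
    ultimately have "u = 0" by blast
    then show ?thesis by (simp add: matrix_vector_mult_0_right)
  next
    case False
    obtain v l where v: "v \<in> V" "v \<noteq> 0" "W *v v = l *\<^sub>R v"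
      and ext: "\<And>u. u \<in> V \<Longrightarrow> norm (W *v u) \<le> \<bar>l\<bar> * norm u"
      using self_adjoint_invariant_subspace_extremal_eigenvector[where T = "(*v) W" and V = V,
          OF matrix_vector_mul_linear symmetric_matrix_inner[OF sym] V inv False] by blast
    have "l \<noteq> 1"
    proof
      assume "l = 1"
      then have "v \<in> span {\<chi> i. 1}"
        using v mixing_matrix_eigenspace_1[OF W] by (auto simp: eigenspace_def)
      then obtain c where "v = c *\<^sub>R (\<chi> i. 1)"
        by (auto simp: span_singleton)
      then have "v $ i = c" for i by simp
      moreover from this have "real CARD('n) * c = 0" using v(1) by (simp add: V_def)
      ultimately have "v = 0" by (simp add: vec_eq_iff)
      then show False using v(2) by simp
    qed
    have l: "l \<in> eigenvalues W" using v by (auto simp: eigenvalues_def)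
    have "W *v (\<chi> i. 1) = 1 *\<^sub>R (\<chi> i. 1)" "((\<chi> i. 1) :: real ^ 'n) \<noteq> 0"
      by (simp_all add: matrix_vector_mult_def vec_eq_iff row)
    then have 1: "1 \<in> eigenvalues W"
      unfolding eigenvalues_def by blast
    have "{#1, l#} \<subseteq># eigenvalue_mset W"
      using eigenspace_dim_pos[OF l] eigenspace_dim_pos[OF 1] \<open>l \<noteq> 1\<close> l 1
      by (auto simp: subseteq_mset_def count_eigenvalue_mset[OF sym] Suc_le_eq)
    then have "size {#k \<in># {#1, l#}. \<bar>l\<bar> \<le> \<bar>k\<bar>#} \<le> size {#k \<in># eigenvalue_mset W. \<bar>l\<bar> \<le> \<bar>k\<bar>#}"
      by (intro size_mset_mono multiset_filter_mono)
    moreover have "\<bar>l\<bar> \<le> 1"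
      using mixing_matrix_eigenvalue_range[OF W l] by simp
    ultimately have "2 \<le> size {#k \<in># eigenvalue_mset W. \<bar>l\<bar> \<le> \<bar>k\<bar>#}"
      by simp
    then have "\<bar>l\<bar> \<le> second_eigenvalue_magnitude W"
      using second_eigenvalue_magnitude_ge_iff[of "\<bar>l\<bar>" W] second_eigenvalue_magnitude_nonneg[of W]
      by (cases "l = 0") auto
    then have "\<bar>l\<bar> * norm u \<le> second_eigenvalue_magnitude W * norm u"
      by (rule mult_right_mono) simp
    then show ?thesis
      using ext[of u] u by (simp add: V_def)
  qed
qed

section \<open>Cocoercivity and gradient steps on convex sets\<close>

text \<open>
  The gradient step from \<open>x\<close> for the function \<open>\<lambda>z. \<phi> z - k y \<bullet> z\<close>, which has its minimum over \<open>S\<close> at \<open>y\<close>,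
  decreases this function by at least the stated quadratic amount, provided that the step stays in \<open>S\<close>. Hence
  the value at \<open>x\<close> exceeds the minimum by that amount.
\<close>

lemma quadratic_bound_step:
  fixes k :: "'a::real_inner \<Rightarrow> 'a"
  assumes lower: "\<And>x y. x \<in> S \<Longrightarrow> y \<in> S \<Longrightarrow> \<phi> x + k x \<bullet> (y - x) \<le> \<phi> y"
    and upper: "\<And>x y. x \<in> S \<Longrightarrow> y \<in> S \<Longrightarrow> \<phi> y \<le> \<phi> x + k x \<bullet> (y - x) + M / 2 * (norm (y - x))\<^sup>2"
    and M: "M > 0" and x: "x \<in> S" and y: "y \<in> S" and step: "x - (1 / M) *\<^sub>R (k x - k y) \<in> S"
  shows "\<phi> y + k y \<bullet> (x - y) + (norm (k x - k y))\<^sup>2 / (2 * M) \<le> \<phi> x"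
proof -
  define d where "d = k x - k y"
  define z where "z = x - (1 / M) *\<^sub>R d"
  have z: "z \<in> S" using step by (simp add: z_def d_def)
  have "\<phi> y + k y \<bullet> (z - y) \<le> \<phi> x + k x \<bullet> (z - x) + M / 2 * (norm (z - x))\<^sup>2"
    using lower[OF y z] upper[OF x z] by linarith
  moreover have "k x \<bullet> (z - x) = - ((k x \<bullet> d) / M)" "k y \<bullet> (z - y) = k y \<bullet> (x - y) - (k y \<bullet> d) / M"
    by (simp_all add: z_def inner_diff_right)
  moreover have "M / 2 * (norm (z - x))\<^sup>2 = (norm d)\<^sup>2 / (2 * M)"
    using M by (simp add: z_def power_divide) (simp add: power2_eq_square)
  moreover have "(k x \<bullet> d) / M = (k y \<bullet> d) / M + 2 * ((norm d)\<^sup>2 / (2 * M))"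
    using M by (simp add: d_def power2_norm_eq_inner inner_diff_left field_simps)
  ultimately show ?thesis
    unfolding d_def[symmetric] by linarith
qed

lemma cocoercive_near:
  fixes k :: "'a::real_inner \<Rightarrow> 'a"
  assumes lower: "\<And>x y. x \<in> S \<Longrightarrow> y \<in> S \<Longrightarrow> \<phi> x + k x \<bullet> (y - x) \<le> \<phi> y"
    and upper: "\<And>x y. x \<in> S \<Longrightarrow> y \<in> S \<Longrightarrow> \<phi> y \<le> \<phi> x + k x \<bullet> (y - x) + M / 2 * (norm (y - x))\<^sup>2"
    and M: "M > 0" and x: "x \<in> S" and y: "y \<in> S"
    and step: "x - (1 / M) *\<^sub>R (k x - k y) \<in> S" "y - (1 / M) *\<^sub>R (k y - k x) \<in> S"
  shows "(norm (k x - k y))\<^sup>2 \<le> M * ((x - y) \<bullet> (k x - k y))"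
proof -
  have "\<phi> y + k y \<bullet> (x - y) + (norm (k x - k y))\<^sup>2 / (2 * M) \<le> \<phi> x"
    using quadratic_bound_step[OF lower upper M x y step(1)] by blast
  moreover have "\<phi> x + k x \<bullet> (y - x) + (norm (k x - k y))\<^sup>2 / (2 * M) \<le> \<phi> y"
    using quadratic_bound_step[OF lower upper M y x step(2)] by (simp add: norm_minus_commute)
  ultimately have "k y \<bullet> (x - y) + k x \<bullet> (y - x) + (norm (k x - k y))\<^sup>2 / M \<le> 0"
    using M by (simp add: field_simps)
  moreover have "k y \<bullet> (x - y) + k x \<bullet> (y - x) = - ((x - y) \<bullet> (k x - k y))"
    by (simp add: inner_diff inner_commute)
  ultimately have "(norm (k x - k y))\<^sup>2 / M \<le> (x - y) \<bullet> (k x - k y)"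
    by linarith
  then show ?thesis
    using M by (simp add: field_simps)
qed

text \<open>
  The inequality of cocoercivity is inherited by a segment from its pieces with the same constant: the left-hand
  side gains a factor \<open>N\<close> from the Cauchy-Schwarz inequality, and the inner products on the right, each with
  \<open>(1 / N) *\<^sub>R v\<close>, sum to \<open>1 / N\<close> times the one for the whole segment.
\<close>

lemma cocoercive_subdivide:
  fixes k :: "'a::real_inner \<Rightarrow> 'a" and N :: nat
  assumes N: "N > 0"
    and loc: "\<And>i. i < N \<Longrightarrow>
      (norm (k (x + (real (Suc i) / N) *\<^sub>R v) - k (x + (real i / N) *\<^sub>R v)))\<^sup>2
        \<le> M * (((1 / N) *\<^sub>R v) \<bullet> (k (x + (real (Suc i) / N) *\<^sub>R v) - k (x + (real i / N) *\<^sub>R v)))"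
  shows "(norm (k (x + v) - k x))\<^sup>2 \<le> M * (v \<bullet> (k (x + v) - k x))"
proof -
  define D where "D = (\<lambda>i. k (x + (real (Suc i) / N) *\<^sub>R v) - k (x + (real i / N) *\<^sub>R v))"
  have tel: "(\<Sum>i<N. D i) = k (x + v) - k x"
    unfolding D_def using N by (subst sum_lessThan_telescope) simp
  have "(norm (\<Sum>i<N. D i))\<^sup>2 \<le> (\<Sum>i<N. norm (D i))\<^sup>2"
    by (intro power_mono norm_sum) simp
  also have "\<dots> \<le> N * (\<Sum>i<N. (norm (D i))\<^sup>2)"
    using sum_squared_le_sum_of_squares[of "\<lambda>i. norm (D i)" "{..<N}"] by (simp add: mult.commute)
  also have "\<dots> \<le> N * (\<Sum>i<N. M * (((1 / N) *\<^sub>R v) \<bullet> D i))"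
    using loc by (intro mult_left_mono sum_mono) (auto simp: D_def)
  also have "\<dots> = M * (v \<bullet> (\<Sum>i<N. D i))"
    using N by (simp add: inner_sum_right sum_distrib_left sum_divide_distrib)
  finally show ?thesis by (simp add: tel)
qed

text \<open>
  The linear subspace parallel to the affine hull of \<open>S\<close>, if \<open>S\<close> is not empty.
\<close>

definition directions :: "'a::real_vector set \<Rightarrow> 'a set" where
  "directions S = span {x - y | x y. x \<in> S \<and> y \<in> S}"

lemma subspace_directions: "subspace (directions S)"
  by (simp add: directions_def)

lemma diff_in_directions: "x \<in> S \<Longrightarrow> y \<in> S \<Longrightarrow> x - y \<in> directions S"
  unfolding directions_def by (intro span_base) blast

lemma affine_hull_plus_directions:
  assumes "c \<in> S" "u \<in> directions S"
  shows "c + u \<in> affine hull S"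
proof -
  let ?T = "span ((\<lambda>x. - c + x) ` S)"
  have "x - y \<in> ?T" if "x \<in> S" "y \<in> S" for x y
  proof -
    have "(- c + x) - (- c + y) \<in> ?T"
      using that by (intro span_diff span_base) auto
    then show ?thesis by simp
  qed
  then have "directions S \<subseteq> ?T"
    unfolding directions_def by (intro span_minimal) auto
  then show ?thesis
    using assms affine_hull_span_gen[of c S] hull_inc[of c S affine] by auto
qed

text \<open>
  Pull \<open>x\<close> and \<open>y\<close> slightly towards a point \<open>c\<close> of the relative interior. The whole segment between the
  new points then has a uniform margin inside \<open>S\<close>, along \<open>directions S\<close>. Pieces of the segment
  that are short enough satisfy the inequality, because the auxiliary gradient steps that prove it stay within the
  margin. The pieces add up, and continuity of \<open>k\<close> allows the pull to tend to zero.
\<close>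

lemma cocoercive_on_convex:
  fixes k :: "'a::euclidean_space \<Rightarrow> 'a"
  assumes S: "convex S"
    and lower: "\<And>x y. x \<in> S \<Longrightarrow> y \<in> S \<Longrightarrow> \<phi> x + k x \<bullet> (y - x) \<le> \<phi> y"
    and upper: "\<And>x y. x \<in> S \<Longrightarrow> y \<in> S \<Longrightarrow> \<phi> y \<le> \<phi> x + k x \<bullet> (y - x) + M / 2 * (norm (y - x))\<^sup>2"
    and M: "M > 0" and lip: "C-lipschitz_on S k"
    and dir: "\<And>x y. x \<in> S \<Longrightarrow> y \<in> S \<Longrightarrow> k x - k y \<in> directions S"
    and x: "x \<in> S" and y: "y \<in> S"
  shows "(norm (k x - k y))\<^sup>2 \<le> M * ((x - y) \<bullet> (k x - k y))"
proof -
  obtain c where "c \<in> rel_interior S"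
    using rel_interior_eq_empty[OF S] x by blast
  then obtain r where c: "c \<in> S" and r: "r > 0" "cball c r \<inter> affine hull S \<subseteq> S"
    by (auto simp: mem_rel_interior_cball)
  define m where "m = (\<lambda>\<epsilon> z. (1 - \<epsilon>) *\<^sub>R z + \<epsilon> *\<^sub>R c)"
  have room: "m \<epsilon> z + u \<in> S"
    if "z \<in> S" "0 < \<epsilon>" "\<epsilon> \<le> 1" "u \<in> directions S" "norm u \<le> \<epsilon> * r" for \<epsilon> z u
  proof -
    have "c + (1 / \<epsilon>) *\<^sub>R u \<in> affine hull S"
      using that c by (intro affine_hull_plus_directions subspace_scale subspace_directions)
    moreover have "norm ((1 / \<epsilon>) *\<^sub>R u) \<le> r"
      using that by (simp add: field_simps)
    ultimately have "c + (1 / \<epsilon>) *\<^sub>R u \<in> S"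
      using r by (auto simp: dist_norm)
    then have "(1 - \<epsilon>) *\<^sub>R z + \<epsilon> *\<^sub>R (c + (1 / \<epsilon>) *\<^sub>R u) \<in> S"
      using that by (intro convexD[OF S]) auto
    then show ?thesis
      using that by (simp add: m_def algebra_simps)
  qed
  have interior: "(norm (k (m \<epsilon> x) - k (m \<epsilon> y)))\<^sup>2 \<le> M * ((m \<epsilon> x - m \<epsilon> y) \<bullet> (k (m \<epsilon> x) - k (m \<epsilon> y)))"
    if \<epsilon>: "0 < \<epsilon>" "\<epsilon> \<le> 1" for \<epsilon>
  proof -
    define v where "v = m \<epsilon> x - m \<epsilon> y"
    (* The pieces have length at most norm v / N, so that the steps, of length at most
       C * norm v / (N * M), fit into the margin \<epsilon> * r. *)
    obtain N :: nat where N: "real N > C * norm v / (M * (\<epsilon> * r))" "N > 0"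
      by (metis reals_Archimedean2 gr0I less_le_trans of_nat_0_le_iff max.strict_boundedE of_nat_0_less_iff)
    define q where "q = (\<lambda>i. m \<epsilon> y + (real i / N) *\<^sub>R v)"
    have q: "\<exists>z\<in>S. q i = m \<epsilon> z" if "i \<le> N" for i
    proof
      show "y + (real i / N) *\<^sub>R (x - y) \<in> S"
        using convexD_alt[OF S y x, of "real i / N"] that N by (simp add: algebra_simps)
      show "q i = m \<epsilon> (y + (real i / N) *\<^sub>R (x - y))"
        by (simp add: q_def v_def m_def algebra_simps)
    qed
    have near: "(norm (k (q (Suc i)) - k (q i)))\<^sup>2 \<le> M * ((q (Suc i) - q i) \<bullet> (k (q (Suc i)) - k (q i)))"
      if i: "i < N" for i
    proof -
      obtain z z' where z: "z \<in> S" "q i = m \<epsilon> z" "z' \<in> S" "q (Suc i) = m \<epsilon> z'"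
        using q[OF less_imp_le[OF i]] q[OF Suc_leI[OF i]] by blast
      have qS: "q i \<in> S" "q (Suc i) \<in> S"
        using room[of z \<epsilon> 0] room[of z' \<epsilon> 0] z \<epsilon> r by (auto simp: subspace_0 subspace_directions)
      have "q (Suc i) - q i = (1 / N) *\<^sub>R v"
        by (simp add: q_def scaleR_left_diff_distrib[symmetric] diff_divide_distrib[symmetric])
      then have "norm (k (q (Suc i)) - k (q i)) \<le> C * (norm v / N)"
        using lipschitz_onD[OF lip qS(2,1)] by (simp add: dist_norm)
      then have "real N * norm (k (q (Suc i)) - k (q i)) \<le> C * norm v"
        using N by (simp add: field_simps)
      also have "\<dots> < real N * (M * (\<epsilon> * r))"
        using N(1) M \<epsilon> r by (simp add: pos_divide_less_eq mult.commute mult.left_commute)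
      finally have "norm (k (q (Suc i)) - k (q i)) < M * (\<epsilon> * r)"
        using N(2) by (simp only: mult_less_cancel_left_pos of_nat_0_less_iff)
      then have "norm (k (q (Suc i)) - k (q i)) / M \<le> \<epsilon> * r"
        using N M by (simp add: field_simps)
      then have "norm ((1 / M) *\<^sub>R (k (q (Suc i)) - k (q i))) \<le> \<epsilon> * r"
        using M unfolding norm_scaleR by simp
      then show ?thesis
        using cocoercive_near[OF lower upper M qS(2,1)]
          room[of z' \<epsilon> "- ((1 / M) *\<^sub>R (k (q (Suc i)) - k (q i)))"]
          room[of z \<epsilon> "- ((1 / M) *\<^sub>R (k (q i) - k (q (Suc i))))"]
          z \<epsilon> dir qS by (simp add: subspace_neg subspace_scale subspace_directions norm_minus_commute)
    qed
    have "q (Suc i) - q i = (1 / N) *\<^sub>R v" for i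
      by (simp add: q_def scaleR_left_diff_distrib[symmetric] diff_divide_distrib[symmetric])
    then have "(norm (k (m \<epsilon> y + v) - k (m \<epsilon> y)))\<^sup>2 \<le> M * (v \<bullet> (k (m \<epsilon> y + v) - k (m \<epsilon> y)))"
      using near N(2) by (intro cocoercive_subdivide[of N]) (auto simp: q_def)
    then show ?thesis by (simp add: v_def)
  qed
  define gap where "gap = (\<lambda>\<epsilon>. M * ((m \<epsilon> x - m \<epsilon> y) \<bullet> (k (m \<epsilon> x) - k (m \<epsilon> y)))
      - (norm (k (m \<epsilon> x) - k (m \<epsilon> y)))\<^sup>2)"
  have mS: "m \<epsilon> z \<in> S" if "\<epsilon> \<in> {0..1}" "z \<in> S" for \<epsilon> z
    using that c by (auto simp: m_def intro!: convexD[OF S])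
  have cont: "continuous_on {0..1} (\<lambda>\<epsilon>. k (m \<epsilon> z))" if "z \<in> S" for z
  proof (rule continuous_on_compose2[OF lipschitz_on_continuous_on[OF lip]])
    show "continuous_on {0..1} (\<lambda>\<epsilon>. m \<epsilon> z)"
      unfolding m_def by (intro continuous_intros)
  qed (use mS that in auto)
  have "0 \<le> gap 0"
  proof (rule continuous_ge_on_closure[of "{0<..1}" gap 0 0])
    have "closure {0<..1::real} = {0..1}" by simp
    then show "continuous_on (closure {0<..1}) gap"
      unfolding gap_def m_def[THEN fun_cong, THEN fun_cong, of _ x] using cont x y
      by (auto simp: m_def intro!: continuous_intros)
  qed (use interior in \<open>auto simp: gap_def\<close>)
  then show ?thesis
    by (simp add: gap_def m_def)
qed

text \<open>
  The function minus the claimed bound is nonincreasing along the segment from \<open>x\<close> to \<open>y\<close>. The derivative is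
  taken within the segment, which also covers sets with empty interior.
\<close>

lemma descent_on_convex:
  fixes g :: "'a::euclidean_space \<Rightarrow> 'a"
  assumes S: "convex S" and g: "gradient_on S f g" and lip: "L-lipschitz_on S g"
    and x: "x \<in> S" and y: "y \<in> S"
  shows "f y \<le> f x + g x \<bullet> (y - x) + L / 2 * (norm (y - x))\<^sup>2"
proof -
  define v where "v = y - x"
  define c where "c = (\<lambda>t::real. x + t *\<^sub>R v)"
  define h where "h = (\<lambda>t. f (c t) - t * (g x \<bullet> v) - L / 2 * t\<^sup>2 * (norm v)\<^sup>2)"
  have cS: "c t \<in> S" if "t \<in> {0..1}" for t
    using convexD_alt[OF S x y, of t] that by (simp add: c_def v_def algebra_simps)
  have cI: "c ` {0..1} \<subseteq> S" using cS by auto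
  have "(h has_derivative (\<lambda>s. s * (g (c t) \<bullet> v - g x \<bullet> v - L * t * (norm v)\<^sup>2))) (at t within {0..1})"
    if t: "t \<in> {0..1}" for t
  proof -
    have "(f has_derivative (\<lambda>h. g (c t) \<bullet> h)) (at (c t) within S)"
      using g cS[OF t] unfolding gradient_on_def by blast
    then have "(f has_derivative (\<lambda>h. g (c t) \<bullet> h)) (at (c t) within c ` {0..1})"
      by (rule has_derivative_subset[OF _ cI])
    moreover have "(c has_derivative (\<lambda>s. s *\<^sub>R v)) (at t within {0..1})"
      unfolding c_def by (auto intro!: derivative_eq_intros)
    ultimately have D: "((\<lambda>t. f (c t)) has_derivative (\<lambda>s. g (c t) \<bullet> (s *\<^sub>R v))) (at t within {0..1})"
      by (rule has_derivative_in_compose[rotated])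
    have "(h has_derivative (\<lambda>s. g (c t) \<bullet> (s *\<^sub>R v) - s * (g x \<bullet> v) - L / 2 * (2 * t * s) * (norm v)\<^sup>2))
        (at t within {0..1})"
      unfolding h_def by (intro has_derivative_diff D) (auto intro!: derivative_eq_intros)
    moreover have "(\<lambda>s. g (c t) \<bullet> (s *\<^sub>R v) - s * (g x \<bullet> v) - L / 2 * (2 * t * s) * (norm v)\<^sup>2)
        = (\<lambda>s. s * (g (c t) \<bullet> v - g x \<bullet> v - L * t * (norm v)\<^sup>2))"
      by (simp add: fun_eq_iff algebra_simps)
    ultimately show ?thesis by simp
  qed
  then obtain t where t: "t \<in> {0..1}"
    and mvt: "h 1 - h 0 = (1 - 0) * (g (c t) \<bullet> v - g x \<bullet> v - L * t * (norm v)\<^sup>2)"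
    using mvt_very_simple[of 0 1 h "\<lambda>t s. s * (g (c t) \<bullet> v - g x \<bullet> v - L * t * (norm v)\<^sup>2)"] by auto
  have "g (c t) \<bullet> v - g x \<bullet> v \<le> norm (g (c t) - g x) * norm v"
    by (metis inner_diff_left norm_cauchy_schwarz)
  also have "\<dots> \<le> L * (t * norm v) * norm v"
    using lipschitz_onD[OF lip cS[OF t] x] t by (intro mult_right_mono) (auto simp: dist_norm c_def)
  finally have "h 1 \<le> h 0"
    using mvt by (simp add: power2_eq_square algebra_simps)
  then show ?thesis
    by (simp add: h_def c_def v_def)
qed

lemma obtain_orthogonal_projection:
  fixes T :: "'a::euclidean_space set"
  assumes T: "subspace T"
  obtains P where "linear P" "\<And>u. P u \<in> T" "\<And>u v. v \<in> T \<Longrightarrow> (u - P u) \<bullet> v = 0"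
    "\<And>u. norm (P u) \<le> norm u"
proof -
  obtain B where B: "B \<subseteq> T" "pairwise orthogonal B" "\<And>b. b \<in> B \<Longrightarrow> norm b = 1"
    "independent B" "span B = T"
    using orthonormal_basis_subspace[OF T] by metis
  have fin: "finite B" using B(4) independent_imp_finite by blast
  define P where "P = (\<lambda>u. \<Sum>b\<in>B. (u \<bullet> b) *\<^sub>R b)"
  have lin: "linear P"
    unfolding P_def by (intro linearI) (simp_all add: inner_add_left scaleR_left_distrib sum.distrib scaleR_sum_right)
  have in_T: "P u \<in> T" for u
    unfolding P_def using B(1) by (intro subspace_sum[OF T] subspace_scale[OF T]) auto
  have orthB: "(u - P u) \<bullet> b = 0" if b: "b \<in> B" for u b
  proof -
    have "(u \<bullet> c) * (c \<bullet> b) = (if c = b then u \<bullet> b else 0)" if "c \<in> B" for c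
      using B(2,3) b that by (auto simp: pairwise_def orthogonal_def dot_square_norm)
    then have "P u \<bullet> b = (\<Sum>c\<in>B. if c = b then u \<bullet> b else 0)"
      by (simp add: P_def inner_sum_left)
    then show ?thesis
      using fin b by (simp add: inner_diff_left)
  qed
  have orth: "(u - P u) \<bullet> v = 0" if "v \<in> T" for u v
  proof -
    have "orthogonal (u - P u) v"
      using orthB that B(5) orthogonal_to_span[of v B "u - P u"] by (auto simp: orthogonal_def)
    then show ?thesis by (simp add: orthogonal_def)
  qed
  have "norm (P u) \<le> norm u" for u
  proof -
    have "(norm (P u + (u - P u)))\<^sup>2 = (norm (P u))\<^sup>2 + (norm (u - P u))\<^sup>2"
      using orth[OF in_T, of u u] by (intro norm_add_Pythagorean) (simp add: orthogonal_def inner_commute)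
    then have "(norm (P u))\<^sup>2 \<le> (norm u)\<^sup>2"
      by simp
    then show ?thesis
      by (rule power2_le_imp_le) simp
  qed
  then show thesis using that lin in_T orth by blast
qed

text \<open>
  A displacement orthogonal to all directions of the set changes the squared distances to all of its points by the
  same amount.
\<close>

lemma closest_point_add_normal:
  fixes S :: "'a::euclidean_space set"
  assumes S: "closed S" "convex S" "S \<noteq> {}" and q: "\<And>v. v \<in> directions S \<Longrightarrow> q \<bullet> v = 0"
  shows "closest_point S (a + q) = closest_point S a"
proof -
  let ?p = "closest_point S a"
  have p: "?p \<in> S" using S closest_point_in_set by blast
  have "dist (a + q) ?p \<le> dist (a + q) z" if z: "z \<in> S" for z
  proof -
    have "(a - ?p) \<bullet> (z - ?p) \<le> 0" by (rule closest_point_dot[OF S(2,1) z])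
    moreover have "q \<bullet> (z - ?p) = 0" using q diff_in_directions[OF z p] by blast
    moreover have "(norm (a + q - z))\<^sup>2 = (norm (a + q - ?p))\<^sup>2 - 2 * ((a + q - ?p) \<bullet> (z - ?p)) + (norm (z - ?p))\<^sup>2"
      by (simp add: power2_norm_eq_inner inner_diff inner_commute algebra_simps)
    moreover have "(a + q - ?p) \<bullet> (z - ?p) = (a - ?p) \<bullet> (z - ?p) + q \<bullet> (z - ?p)"
      by (simp add: algebra_simps)
    ultimately have "(norm (a + q - ?p))\<^sup>2 \<le> (norm (a + q - z))\<^sup>2"
      using zero_le_power2[of "norm (z - ?p)"] by linarith
    then show ?thesis unfolding dist_norm by (rule power2_le_imp_le) simp
  qed
  then show ?thesis
    using closest_point_unique[OF S(2,1) p] by metis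
qed

text \<open>
  Cocoercivity is applied to \<open>\<phi> z = f z - \<mu> / 2 * (norm z)\<^sup>2\<close>, which is convex and has the quadratic upper bound
  with constant \<open>L - \<mu>\<close>. Its gradient enters only through inner products with directions of \<open>S\<close>, so the tangential part
  \<open>P (g z)\<close> of the gradient serves as well, and it is the right choice when \<open>g z\<close> also has a component
  normal to \<open>S\<close>: that component could destroy the contraction.
\<close>

lemma gradient_step_contraction:
  fixes g :: "'a::euclidean_space \<Rightarrow> 'a"
  assumes S: "convex S" and g: "gradient_on S f g" and lip: "L-lipschitz_on S g"
    and sc: "strongly_convex_on \<mu> S f g" and mu: "\<mu> > 0"
    and P: "linear P" "\<And>u. P u \<in> directions S" "\<And>u v. v \<in> directions S \<Longrightarrow> (u - P u) \<bullet> v = 0"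
      "\<And>u. norm (P u) \<le> norm u"
    and a: "0 \<le> a" "a \<le> 2 / (L + \<mu>)"
    and x: "x \<in> S" and y: "y \<in> S"
  shows "(norm (x - y - a *\<^sub>R (P (g x) - P (g y))))\<^sup>2 \<le> (1 - a * \<mu>) * (norm (x - y))\<^sup>2"
proof (cases "x = y")
  case False
  define k where "k = (\<lambda>z. P (g z) - \<mu> *\<^sub>R z)"
  define \<phi> where "\<phi> = (\<lambda>z. f z - \<mu> / 2 * (norm z)\<^sup>2)"
  have Pg: "P (g z) \<bullet> (w - z) = g z \<bullet> (w - z)" if "z \<in> S" "w \<in> S" for z w
    using P(3)[OF diff_in_directions[OF that(2,1)], of "g z"] by (simp add: inner_diff_left)
  have lower: "\<phi> z + k z \<bullet> (w - z) \<le> \<phi> w" if "z \<in> S" "w \<in> S" for z w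
  proof -
    have "f z + (w - z) \<bullet> g z + \<mu> / 2 * (norm (w - z))\<^sup>2 \<le> f w"
      using sc that by (auto simp: strongly_convex_on_def)
    then show ?thesis
      using Pg[OF that] by (simp add: \<phi>_def k_def power2_norm_eq_inner inner_diff inner_commute algebra_simps)
  qed
  have L0: "0 \<le> L" using lip by (rule lipschitz_on_nonneg)
  have upper: "\<phi> w \<le> \<phi> z + k z \<bullet> (w - z) + (L - \<mu>) / 2 * (norm (w - z))\<^sup>2" if "z \<in> S" "w \<in> S" for z w
    using descent_on_convex[OF S g lip that] Pg[OF that]
    by (simp add: \<phi>_def k_def power2_norm_eq_inner inner_diff inner_commute algebra_simps diff_divide_distrib)
  have "\<mu> / 2 * (norm (x - y))\<^sup>2 \<le> L / 2 * (norm (x - y))\<^sup>2"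
    using lower[OF y x] upper[OF y x] by (simp add: algebra_simps diff_divide_distrib)
  then have "\<mu> \<le> L" using False by simp
  have "dist (P (g z)) (P (g w)) \<le> L * dist z w" if "z \<in> S" "w \<in> S" for z w
    using P(4)[of "g z - g w"] lipschitz_onD[OF lip that] by (simp add: dist_norm linear_diff[OF P(1)])
  then have "L-lipschitz_on S (\<lambda>z. P (g z))"
    using L0 by (intro lipschitz_onI)
  then have lipk: "(L + \<bar>\<mu>\<bar> * 1)-lipschitz_on S k"
    unfolding k_def by (intro lipschitz_intros)
  have dir: "k z - k w \<in> directions S" if "z \<in> S" "w \<in> S" for z w
  proof -
    have "P (g z) - P (g w) - \<mu> *\<^sub>R (z - w) \<in> directions S"
      by (intro subspace_diff subspace_scale subspace_directions P(2) diff_in_directions that)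
    then show ?thesis by (simp add: k_def algebra_simps)
  qed
  define v where "v = x - y"
  define d where "d = k x - k y"
  (* Cocoercivity needs a positive constant, whereas L = \<mu> is possible. *)
  have "(norm d)\<^sup>2 \<le> (L - \<mu> + e) * (v \<bullet> d)" if "e > 0" for e
    unfolding d_def v_def
  proof (rule cocoercive_on_convex[OF S _ _ _ lipk dir x y, of \<phi>])
    fix z w assume zw: "z \<in> S" "w \<in> S"
    have "(L - \<mu>) / 2 * (norm (w - z))\<^sup>2 \<le> (L - \<mu> + e) / 2 * (norm (w - z))\<^sup>2"
      using that by (intro mult_right_mono) auto
    then show "\<phi> w \<le> \<phi> z + k z \<bullet> (w - z) + (L - \<mu> + e) / 2 * (norm (w - z))\<^sup>2"
      using upper[OF zw] by linarith
  qed (use lower that \<open>\<mu> \<le> L\<close> in auto)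
  then have "eventually (\<lambda>e. (norm d)\<^sup>2 \<le> (L - \<mu> + e) * (v \<bullet> d)) (at_right 0)"
    by (auto simp: eventually_at_filter)
  moreover have "((\<lambda>e. (L - \<mu> + e) * (v \<bullet> d)) \<longlongrightarrow> (L - \<mu> + 0) * (v \<bullet> d)) (at_right 0)"
    by (intro tendsto_intros)
  ultimately have coco: "(norm d)\<^sup>2 \<le> (L - \<mu>) * (v \<bullet> d)"
    using tendsto_lowerbound[of _ _ "at_right (0::real)"] by fastforce
  have "0 \<le> v \<bullet> d"
    using lower[OF x y] lower[OF y x] by (simp add: v_def d_def inner_diff inner_commute)
  have "a * (L + \<mu>) \<le> 2"
    using a L0 mu by (simp add: field_simps)
  then have am: "a * \<mu> \<le> 1" "0 \<le> a * \<mu>"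
    using mult_left_mono[OF \<open>\<mu> \<le> L\<close> a(1)] a mu by (auto simp: distrib_left)
  have "x - y - a *\<^sub>R (P (g x) - P (g y)) = (1 - a * \<mu>) *\<^sub>R v - a *\<^sub>R d"
    by (simp add: v_def d_def k_def algebra_simps)
  moreover have "(norm ((1 - a * \<mu>) *\<^sub>R v - a *\<^sub>R d))\<^sup>2
      = (1 - a * \<mu>)\<^sup>2 * (norm v)\<^sup>2 - 2 * a * (1 - a * \<mu>) * (v \<bullet> d) + a\<^sup>2 * (norm d)\<^sup>2"
    unfolding power2_norm_eq_inner inner_diff_left inner_diff_right
    by (simp add: inner_commute[of d v] power2_eq_square algebra_simps)
  ultimately have "(norm (x - y - a *\<^sub>R (P (g x) - P (g y))))\<^sup>2
      = (1 - a * \<mu>)\<^sup>2 * (norm v)\<^sup>2 - 2 * a * (1 - a * \<mu>) * (v \<bullet> d) + a\<^sup>2 * (norm d)\<^sup>2"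
    by simp
  also have "\<dots> \<le> (1 - a * \<mu>)\<^sup>2 * (norm v)\<^sup>2 - 2 * a * (1 - a * \<mu>) * (v \<bullet> d) + a\<^sup>2 * ((L - \<mu>) * (v \<bullet> d))"
    using coco by (simp add: mult_left_mono)
  also have "\<dots> = (1 - a * \<mu>)\<^sup>2 * (norm v)\<^sup>2 - a * (v \<bullet> d) * (2 - a * (L + \<mu>))"
    by (simp add: algebra_simps power2_eq_square)
  also have "\<dots> \<le> (1 - a * \<mu>)\<^sup>2 * (norm v)\<^sup>2"
    using a \<open>0 \<le> v \<bullet> d\<close> \<open>a * (L + \<mu>) \<le> 2\<close> by simp
  also have "(1 - a * \<mu>)\<^sup>2 \<le> 1 - a * \<mu>"
    using am by (simp add: power2_eq_square mult_left_le)
  finally show ?thesis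
    by (simp add: v_def mult_right_mono)
qed simp

lemma minimizer_variational_inequality:
  fixes g :: "'a::euclidean_space \<Rightarrow> 'a"
  assumes S: "convex S" and g: "gradient_on S f g"
    and min: "is_arg_min f (\<lambda>z. z \<in> S) x" and y: "y \<in> S"
  shows "0 \<le> g x \<bullet> (y - x)"
proof -
  have x: "x \<in> S" and le: "\<And>z. z \<in> S \<Longrightarrow> f x \<le> f z"
    using min by (simp_all add: is_arg_min_linorder)
  define c where "c = (\<lambda>t::real. x + t *\<^sub>R (y - x))"
  have cS: "c t \<in> S" if "t \<in> {0..1}" for t
    using convexD_alt[OF S x y, of t] that by (simp add: c_def algebra_simps)
  have c0: "c 0 = x" by (simp add: c_def)
  have cI: "c ` {0..1} \<subseteq> S" using cS by auto
  have "(f has_derivative (\<lambda>h. g x \<bullet> h)) (at x within S)"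
    using g x unfolding gradient_on_def by blast
  then have "(f has_derivative (\<lambda>h. g x \<bullet> h)) (at (c 0) within c ` {0..1})"
    unfolding c0 by (rule has_derivative_subset[OF _ cI])
  moreover have "(c has_derivative (\<lambda>s. s *\<^sub>R (y - x))) (at 0 within {0..1})"
    unfolding c_def by (auto intro!: derivative_eq_intros)
  ultimately have "((\<lambda>t. f (c t)) has_derivative (\<lambda>s. g x \<bullet> (s *\<^sub>R (y - x)))) (at 0 within {0..1})"
    by (rule has_derivative_in_compose[rotated])
  then have "((\<lambda>t. f (c t)) has_real_derivative (g x \<bullet> (y - x))) (at 0 within {0..1})"
    by (simp add: has_field_derivative_def mult.commute[of _ "g x \<bullet> (y - x)"])
  then have lim: "((\<lambda>t. (f (c t) - f x) / t) \<longlongrightarrow> g x \<bullet> (y - x)) (at 0 within {0..1})"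
    by (simp add: has_field_derivative_iff c_def)
  have "eventually (\<lambda>t. 0 \<le> (f (c t) - f x) / t) (at 0 within {0..1})"
    using le cS by (auto simp: eventually_at_filter intro!: always_eventually divide_nonneg_nonneg)
  then show ?thesis
    using tendsto_lowerbound[OF lim] by (simp add: at_within_Icc_at_right)
qed

text \<open>
  By the variational inequality \<open>0 \<le> g x \<bullet> (z - x)\<close>, moving from the minimizer against the gradient does not bring
  it closer to any other point of the set.
\<close>

lemma minimizer_projected_fixpoint:
  fixes g :: "'a::euclidean_space \<Rightarrow> 'a"
  assumes S: "convex S" "closed S" and g: "gradient_on S f g"
    and min: "is_arg_min f (\<lambda>z. z \<in> S) x" and a: "0 \<le> a"
  shows "closest_point S (x - a *\<^sub>R g x) = x"
proof -
  have x: "x \<in> S" using min by (simp add: is_arg_min_def)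
  have "dist (x - a *\<^sub>R g x) x \<le> dist (x - a *\<^sub>R g x) z" if z: "z \<in> S" for z
  proof -
    have "0 \<le> a * (g x \<bullet> (z - x))"
      using minimizer_variational_inequality[OF S(1) g min z] a by simp
    moreover have "(norm (x - a *\<^sub>R g x - z))\<^sup>2 = (norm (a *\<^sub>R g x + (z - x)))\<^sup>2"
      by (metis norm_minus_commute diff_diff_eq2 add_diff_eq add.commute diff_add_eq)
    moreover have "(norm (a *\<^sub>R g x + (z - x)))\<^sup>2
        = (norm (a *\<^sub>R g x))\<^sup>2 + 2 * (a * (g x \<bullet> (z - x))) + (norm (z - x))\<^sup>2"
      unfolding power2_norm_eq_inner inner_add_left inner_add_right
      by (simp add: inner_commute[of "z - x" "g x"])
    ultimately have "(norm (a *\<^sub>R g x))\<^sup>2 \<le> (norm (x - a *\<^sub>R g x - z))\<^sup>2"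
      by simp
    then have "norm (a *\<^sub>R g x) \<le> norm (x - a *\<^sub>R g x - z)"
      by (rule power2_le_imp_le) simp
    then show ?thesis by (simp add: dist_norm)
  qed
  then show ?thesis
    using closest_point_unique[OF S x] by metis
qed

lemma gradient_on_average:
  fixes fi :: "'n::finite \<Rightarrow> 'a::real_inner \<Rightarrow> real"
  assumes "\<And>i. gradient_on S (fi i) (g i)"
  shows "gradient_on S (\<lambda>z. c * (\<Sum>i\<in>UNIV. fi i z)) (\<lambda>z. c *\<^sub>R (\<Sum>i\<in>UNIV. g i z))"
  unfolding gradient_on_def
proof
  fix z assume "z \<in> S"
  then have "((\<lambda>z. c * (\<Sum>i\<in>UNIV. fi i z)) has_derivative (\<lambda>h. c * (\<Sum>i\<in>UNIV. g i z \<bullet> h))) (at z within S)"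
    using assms by (intro has_derivative_mult_right has_derivative_sum) (simp add: gradient_on_def)
  then show "((\<lambda>z. c * (\<Sum>i\<in>UNIV. fi i z)) has_derivative (\<lambda>h. (c *\<^sub>R (\<Sum>i\<in>UNIV. g i z)) \<bullet> h)) (at z within S)"
    by (simp add: inner_sum_left)
qed

lemma lipschitz_on_average:
  fixes g :: "'n::finite \<Rightarrow> 'a::real_normed_vector \<Rightarrow> 'b::real_normed_vector"
  assumes "\<And>i. L-lipschitz_on S (g i)"
  shows "L-lipschitz_on S (\<lambda>z. (1 / real CARD('n)) *\<^sub>R (\<Sum>i\<in>UNIV. g i z))"
proof (rule lipschitz_onI)
  fix x y assume "x \<in> S" "y \<in> S"
  then have "norm (\<Sum>i\<in>UNIV. g i x - g i y) \<le> (\<Sum>i\<in>(UNIV :: 'n set). L * dist x y)"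
    using lipschitz_onD[OF assms] by (intro sum_norm_le) (simp add: dist_norm)
  then show "dist ((1 / real CARD('n)) *\<^sub>R (\<Sum>i\<in>UNIV. g i x)) ((1 / real CARD('n)) *\<^sub>R (\<Sum>i\<in>UNIV. g i y)) \<le> L * dist x y"
    by (simp add: dist_norm scaleR_diff_right[symmetric] sum_subtractf[symmetric] field_simps)
qed (rule lipschitz_on_nonneg[OF assms])

section \<open>One step of the decentralized iteration\<close>

definition mix :: "real ^ 'n ^ 'n \<Rightarrow> real ^ 'd ^ 'n::finite \<Rightarrow> real ^ 'd ^ 'n" where
  "mix W y = (\<chi> i. \<Sum>j\<in>UNIV. W $ i $ j *\<^sub>R y $ j)"

definition dev :: "real ^ 'd ^ 'n::finite \<Rightarrow> real ^ 'd ^ 'n" where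
  "dev y = y - stack (agent_mean y)"

lemma norm_sq_stacked: "(norm y)\<^sup>2 = (\<Sum>i\<in>UNIV. (norm (y $ i))\<^sup>2)" for y :: "real ^ 'd ^ 'n::finite"
  by (simp add: norm_vec_def L2_set_def sum_nonneg)

lemma norm_sq_stack: "(norm (stack z :: real ^ 'd ^ 'n::finite))\<^sup>2 = real CARD('n) * (norm z)\<^sup>2"
  by (simp add: norm_sq_stacked stack_def)

lemma stack_diff: "stack (a - b) = stack a - stack b"
  by (simp add: stack_def vec_eq_iff)

lemma stack_scaleR: "stack (c *\<^sub>R a) = c *\<^sub>R stack a"
  by (simp add: stack_def vec_eq_iff)

lemma agent_mean_diff: "agent_mean (a - b) = agent_mean a - agent_mean b"
  by (simp add: agent_mean_def sum_subtractf algebra_simps)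

lemma agent_mean_scaleR: "agent_mean (c *\<^sub>R a) = c *\<^sub>R agent_mean a"
  by (simp add: agent_mean_def scaleR_sum_right[symmetric])

lemma agent_mean_stack: "agent_mean (stack z :: real ^ 'd ^ 'n::finite) = z"
  by (simp add: agent_mean_def stack_def sum_constant_scaleR del: sum_constant)

lemma agent_mean_dev: "agent_mean (dev y) = 0"
  by (simp add: dev_def agent_mean_diff agent_mean_stack)

lemma agent_mean_in_convex:
  fixes y :: "real ^ 'd ^ 'n::finite"
  assumes "convex S" "\<And>i. y $ i \<in> S"
  shows "agent_mean y \<in> S"
  using convex_sum[of UNIV S "\<lambda>i. 1 / real CARD('n)" "\<lambda>i. y $ i"] assms
  by (simp add: agent_mean_def scaleR_sum_right)

text \<open>
  The deviations from the mean are orthogonal to the consensus states \<open>stack c\<close>.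
\<close>

lemma norm_sq_diff_stack:
  fixes y :: "real ^ 'd ^ 'n::finite"
  shows "(norm (y - stack c))\<^sup>2 = (norm (dev y))\<^sup>2 + (norm (stack (agent_mean y - c) :: real ^ 'd ^ 'n))\<^sup>2"
proof -
  have "dev y \<bullet> stack z = 0" for z
  proof -
    have "dev y \<bullet> stack z = (\<Sum>i\<in>UNIV. dev y $ i) \<bullet> z"
      unfolding stack_def inner_vec_def[of "dev y"] inner_sum_left by simp
    also have "(\<Sum>i\<in>UNIV. dev y $ i) = 0"
      using agent_mean_dev[of y] by (simp add: agent_mean_def)
    finally show ?thesis by simp
  qed
  then have "(norm (dev y + stack (agent_mean y - c)))\<^sup>2
      = (norm (dev y))\<^sup>2 + (norm (stack (agent_mean y - c) :: real ^ 'd ^ 'n))\<^sup>2"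
    by (intro norm_add_Pythagorean) (simp add: orthogonal_def)
  then show ?thesis by (simp add: dev_def stack_diff)
qed

lemma norm_dev_le_diff_stack: "norm (dev y) \<le> norm (y - stack c)"
  by (rule power2_le_imp_le) (simp_all add: norm_sq_diff_stack)

lemma norm_dev_le: "norm (dev y) \<le> norm y"
  using norm_dev_le_diff_stack[of y 0] by (simp add: stack_def zero_vec_def[symmetric])

lemma norm_stack_mean_le:
  fixes y :: "real ^ 'd ^ 'n::finite"
  shows "norm (stack (agent_mean y) :: real ^ 'd ^ 'n) \<le> norm y"
proof (rule power2_le_imp_le)
  have "(norm y)\<^sup>2 = (norm (dev y))\<^sup>2 + (norm (stack (agent_mean y) :: real ^ 'd ^ 'n))\<^sup>2"
    using norm_sq_diff_stack[of y 0] by (simp add: stack_def zero_vec_def[symmetric])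
  then show "(norm (stack (agent_mean y) :: real ^ 'd ^ 'n))\<^sup>2 \<le> (norm y)\<^sup>2" by simp
qed simp

lemma agent_mean_mix:
  assumes "mixing_matrix E W"
  shows "agent_mean (mix W y) = agent_mean y"
proof -
  have "(\<Sum>i\<in>UNIV. mix W y $ i) = (\<Sum>j\<in>UNIV. (\<Sum>i\<in>UNIV. W $ i $ j) *\<^sub>R y $ j)"
    unfolding mix_def vec_lambda_beta scaleR_sum_left by (rule sum.swap)
  then show ?thesis
    using assms by (simp add: agent_mean_def mixing_matrix_def)
qed

text \<open>
  Mixing fixes all consensus states and preserves means.
\<close>

lemma dev_mix:
  fixes W :: "real ^ 'n ^ 'n::finite" and y :: "real ^ 'd ^ 'n"
  assumes "mixing_matrix E W"
  shows "dev (mix W y) = mix W (dev y)"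
proof -
  have "mix W (stack z) = stack z" for z :: "real ^ 'd"
    using assms by (simp add: mix_def stack_def mixing_matrix_def scaleR_sum_left[symmetric])
  moreover have "mix W (y - z) = mix W y - mix W z" for z
    by (simp add: mix_def vec_eq_iff right_diff_distrib sum_subtractf)
  ultimately show ?thesis
    by (simp add: dev_def agent_mean_mix[OF assms])
qed

lemma norm_sq_by_coordinates:
  fixes y :: "real ^ 'd ^ 'n::finite"
  shows "(norm y)\<^sup>2 = (\<Sum>k\<in>UNIV. (norm (\<chi> i. y $ i $ k))\<^sup>2)"
proof -
  have "(norm y)\<^sup>2 = (\<Sum>i\<in>UNIV. \<Sum>k\<in>UNIV. (y $ i $ k)\<^sup>2)"
    by (simp add: norm_vec_def L2_set_def sum_nonneg)
  also have "\<dots> = (\<Sum>k\<in>UNIV. \<Sum>i\<in>UNIV. (y $ i $ k)\<^sup>2)"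
    by (rule sum.swap)
  finally show ?thesis
    by (simp add: norm_vec_def L2_set_def sum_nonneg)
qed

text \<open>
  The mixing matrix acts on each of the coordinates of the agents' states separately.
\<close>

lemma norm_dev_mix_le:
  fixes y :: "real ^ 'd ^ 'n::finite"
  assumes W: "mixing_matrix E W"
  shows "norm (dev (mix W y)) \<le> second_eigenvalue_magnitude W * norm (dev y)"
proof -
  let ?\<beta> = "second_eigenvalue_magnitude W"
  have "norm (\<chi> i. mix W (dev y) $ i $ k) \<le> ?\<beta> * norm (\<chi> i. dev y $ i $ k)" for k
  proof -
    have "(\<chi> i. mix W (dev y) $ i $ k) = W *v (\<chi> i. dev y $ i $ k)"
      by (simp add: mix_def matrix_vector_mult_def vec_eq_iff)
    moreover have "(\<Sum>i\<in>UNIV. (\<chi> i. dev y $ i $ k) $ i) = 0"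
      using arg_cong[OF agent_mean_dev[of y], of "\<lambda>z. z $ k"] by (simp add: agent_mean_def)
    ultimately show ?thesis
      using mixing_matrix_contracts_mean_zero[OF W] by metis
  qed
  then have "(norm (\<chi> i. mix W (dev y) $ i $ k))\<^sup>2 \<le> ?\<beta>\<^sup>2 * (norm (\<chi> i. dev y $ i $ k))\<^sup>2" for k
    by (metis norm_ge_zero power_mono power_mult_distrib)
  then have "(norm (mix W (dev y)))\<^sup>2 \<le> (?\<beta> * norm (dev y))\<^sup>2"
    unfolding norm_sq_by_coordinates[of "mix W (dev y)"] power_mult_distrib norm_sq_by_coordinates[of "dev y"]
      sum_distrib_left by (intro sum_mono) auto
  then show ?thesis
    unfolding dev_mix[OF W] by (rule power2_le_imp_le) (simp add: second_eigenvalue_magnitude_nonneg)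
qed

lemma projected_step_nonexpansive:
  fixes u z :: "real ^ 'd ^ 'n::finite"
  assumes "convex \<Omega>" "closed \<Omega>" "\<Omega> \<noteq> {}"
  shows "norm ((\<chi> i. closest_point \<Omega> (u $ i)) - (\<chi> i. closest_point \<Omega> (z $ i))) \<le> norm (u - z)"
proof -
  have "(norm ((\<chi> i. closest_point \<Omega> (u $ i)) - (\<chi> i. closest_point \<Omega> (z $ i))))\<^sup>2 \<le> (norm (u - z))\<^sup>2"
    unfolding norm_sq_stacked using closest_point_lipschitz[OF assms]
    by (intro sum_mono power_mono) (auto simp: dist_norm)
  then show ?thesis by (rule power2_le_imp_le) simp
qed

text \<open>
  The new state is compared with the old mean instead of its own mean. The old mean is feasible, hence fixed by
  the projection, and the new mean is at least as close to the new state.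
\<close>

lemma consensus_error_step:
  fixes y d :: "real ^ 'd ^ 'n::finite"
  assumes \<Omega>: "convex \<Omega>" "closed \<Omega>" "\<Omega> \<noteq> {}" and W: "mixing_matrix E W"
    and y: "\<And>i. y $ i \<in> \<Omega>" and a: "0 \<le> a"
    and y': "y' = (\<chi> i. closest_point \<Omega> ((mix W y - a *\<^sub>R d) $ i))"
  shows "norm (dev y') \<le> second_eigenvalue_magnitude W * norm (dev y) + a * norm d"
proof -
  have m: "agent_mean y \<in> \<Omega>" using agent_mean_in_convex \<Omega>(1) y by blast
  have "norm (dev y') \<le> norm (y' - stack (agent_mean y))"
    by (rule norm_dev_le_diff_stack)
  also have "stack (agent_mean y) = (\<chi> i. closest_point \<Omega> (stack (agent_mean y) $ i))"
    using m by (simp add: stack_def closest_point_self)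
  also have "norm (y' - (\<chi> i. closest_point \<Omega> (stack (agent_mean y) $ i)))
      \<le> norm (mix W y - a *\<^sub>R d - stack (agent_mean y))"
    unfolding y' by (rule projected_step_nonexpansive[OF \<Omega>])
  also have "mix W y - a *\<^sub>R d - stack (agent_mean y) = dev (mix W y) - a *\<^sub>R d"
    by (simp add: dev_def agent_mean_mix[OF W])
  also have "norm \<dots> \<le> norm (dev (mix W y)) + norm (a *\<^sub>R d)"
    by (rule norm_triangle_ineq4)
  finally show ?thesis
    using norm_dev_mix_le[OF W, of y] a by simp
qed

text \<open>
  The minimizer is written as a projected gradient step for the average function, with \<open>b\<close> as its gradient, so
  that nonexpansiveness of the projection removes it on both sides. This stacked step is the same for all agents and so
  contributes to the mean part only, even if the local gradients at the minimizer disagree.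
\<close>

lemma distance_step:
  fixes y d :: "real ^ 'd ^ 'n::finite"
  assumes \<Omega>: "convex \<Omega>" "closed \<Omega>" "\<Omega> \<noteq> {}" and W: "mixing_matrix E W" and a: "0 \<le> a"
    and y': "y' = (\<chi> i. closest_point \<Omega> ((mix W y - a *\<^sub>R d) $ i))"
    and fixp: "closest_point \<Omega> (xs - a *\<^sub>R b) = xs"
  shows "(norm (y' - stack xs))\<^sup>2
    \<le> (second_eigenvalue_magnitude W * norm (dev y) + a * norm d)\<^sup>2
      + (norm (stack (agent_mean y - xs - a *\<^sub>R (agent_mean d - b)) :: real ^ 'd ^ 'n))\<^sup>2"
proof -
  define q where "q = mix W y - a *\<^sub>R d"
  have "stack xs = (\<chi> i. closest_point \<Omega> (stack (xs - a *\<^sub>R b) $ i))"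
    by (simp add: stack_def fixp)
  then have "norm (y' - stack xs) \<le> norm (q - stack (xs - a *\<^sub>R b))"
    using projected_step_nonexpansive[OF \<Omega>] unfolding y' q_def by metis
  then have "(norm (y' - stack xs))\<^sup>2 \<le> (norm (q - stack (xs - a *\<^sub>R b)))\<^sup>2"
    by (simp add: power_mono)
  also have "\<dots> = (norm (dev q))\<^sup>2 + (norm (stack (agent_mean q - (xs - a *\<^sub>R b)) :: real ^ 'd ^ 'n))\<^sup>2"
    by (rule norm_sq_diff_stack)
  also have "agent_mean q - (xs - a *\<^sub>R b) = agent_mean y - xs - a *\<^sub>R (agent_mean d - b)"
    by (simp add: q_def agent_mean_diff agent_mean_scaleR agent_mean_mix[OF W] algebra_simps)
  also have "(norm (dev q))\<^sup>2 \<le> (second_eigenvalue_magnitude W * norm (dev y) + a * norm d)\<^sup>2"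
  proof (rule power_mono)
    have "dev q = dev (mix W y) - a *\<^sub>R dev d"
      by (simp add: q_def dev_def agent_mean_diff agent_mean_scaleR stack_diff stack_scaleR algebra_simps)
    then have "norm (dev q) \<le> norm (dev (mix W y)) + a * norm (dev d)"
      using norm_triangle_ineq4[of "dev (mix W y)" "a *\<^sub>R dev d"] a by simp
    then show "norm (dev q) \<le> second_eigenvalue_magnitude W * norm (dev y) + a * norm d"
      using norm_dev_mix_le[OF W, of y] mult_left_mono[OF norm_dev_le[of d] a] by linarith
  qed simp
  finally show ?thesis by simp
qed

lemma norm_sq_local_gradients_le:
  fixes y :: "real ^ 'd ^ 'n::finite" and g :: "'n \<Rightarrow> real ^ 'd \<Rightarrow> real ^ 'd"
  assumes lip: "\<And>i. L-lipschitz_on \<Omega> (g i)" and y: "\<And>i. y $ i \<in> \<Omega>" and z: "z \<in> \<Omega>"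
  shows "(norm ((\<chi> i. g i (y $ i)) - (\<chi> i. g i z)))\<^sup>2 \<le> L\<^sup>2 * (norm (y - stack z))\<^sup>2"
  unfolding norm_sq_stacked sum_distrib_left
proof (rule sum_mono)
  fix i
  have "norm (g i (y $ i) - g i z) \<le> L * norm (y $ i - z)"
    using lipschitz_onD[OF lip y z] by (simp add: dist_norm)
  then show "(norm (((\<chi> i. g i (y $ i)) - (\<chi> i. g i z)) $ i))\<^sup>2 \<le> L\<^sup>2 * (norm ((y - stack z) $ i))\<^sup>2"
    using power_mono[of _ _ 2] by (fastforce simp: stack_def power_mult_distrib)
qed

lemma norm_sq_gradient_bound:
  fixes y :: "real ^ 'd ^ 'n::finite" and g :: "'n \<Rightarrow> real ^ 'd \<Rightarrow> real ^ 'd"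
  assumes lip: "\<And>i. L-lipschitz_on \<Omega> (g i)" and y: "\<And>i. y $ i \<in> \<Omega>" and z: "z \<in> \<Omega>"
    and R: "\<And>i. (norm (g i z))\<^sup>2 \<le> R"
  shows "(norm (\<chi> i. g i (y $ i)))\<^sup>2 \<le> 3 * L\<^sup>2 * (norm (y - stack z))\<^sup>2 + 3 * (real CARD('n) * R)"
proof -
  define d0 where "d0 = (\<chi> i. g i z)"
  define e where "e = (\<chi> i. g i (y $ i)) - (\<chi> i. g i z)"
  have "(norm d0)\<^sup>2 \<le> (\<Sum>i\<in>(UNIV :: 'n set). R)"
    unfolding norm_sq_stacked using R by (intro sum_mono) (simp add: d0_def)
  then have d0: "(norm d0)\<^sup>2 \<le> real CARD('n) * R" by simp
  have e: "(norm e)\<^sup>2 \<le> L\<^sup>2 * (norm (y - stack z))\<^sup>2"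
    unfolding e_def by (rule norm_sq_local_gradients_le[OF lip y z])
  have "(\<chi> i. g i (y $ i)) = e + d0" by (simp add: e_def d0_def)
  then have "(norm (\<chi> i. g i (y $ i)))\<^sup>2 \<le> (norm e + norm d0)\<^sup>2"
    by (simp add: norm_triangle_ineq power_mono)
  also have "\<dots> \<le> 3 * (norm e)\<^sup>2 + 3 * (norm d0)\<^sup>2"
    using zero_le_power2[of "norm e - norm d0"] zero_le_power2[of "norm e"] zero_le_power2[of "norm d0"]
    unfolding power2_sum power2_diff by linarith
  finally show ?thesis using d0 e by simp
qed

lemma young_convex_square:
  fixes \<beta> :: real
  assumes "0 \<le> \<beta>" "\<beta> < 1"
  shows "(\<beta> * b + c)\<^sup>2 \<le> \<beta> * b\<^sup>2 + c\<^sup>2 / (1 - \<beta>)"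
proof -
  have "\<beta> * b\<^sup>2 + c\<^sup>2 / (1 - \<beta>) - (\<beta> * b + c)\<^sup>2 = \<beta> / (1 - \<beta>) * ((1 - \<beta>) * b - c)\<^sup>2"
    using assms by (simp add: field_simps power2_eq_square)
  also have "\<dots> \<ge> 0" using assms by simp
  finally show ?thesis by simp
qed

text \<open>
  The deviation part of the unprojected step yields \<open>\<beta> B\<close> and the terms with \<open>c1\<close> and \<open>c2\<close>. The mean part is the
  difference \<open>u\<close> of the exact gradient steps
  from the mean and from the minimizer, minus an error \<open>a *\<^sub>R e\<close>, since the local gradients are evaluated at the agents'
  states instead of their mean. The steps contract the squared distance by \<open>1 - a * \<mu>\<close>; up to half of this
  gain is given up to absorb the cross term of \<open>u\<close> and \<open>e\<close>, which leads to \<open>c4\<close>.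
\<close>

lemma mean_error_step:
  fixes y :: "real ^ 'd ^ 'n::finite" and g :: "'n \<Rightarrow> real ^ 'd \<Rightarrow> real ^ 'd"
  assumes \<Omega>: "convex \<Omega>" "closed \<Omega>" "\<Omega> \<noteq> {}" and W: "mixing_matrix E W"
    and lip: "\<And>i. L-lipschitz_on \<Omega> (g i)" and mu: "\<mu> > 0" and a: "0 \<le> a"
    and y: "\<And>i. y $ i \<in> \<Omega>" and xs: "xs \<in> \<Omega>" and R: "\<And>i. (norm (g i xs))\<^sup>2 \<le> R"
    and G: "\<And>z. G z = agent_mean (\<chi> i. g i z)"
    and fixp: "closest_point \<Omega> (xs - a *\<^sub>R G xs) = xs"
    and contr: "\<And>z. z \<in> \<Omega> \<Longrightarrow> (norm (z - xs - a *\<^sub>R (G z - G xs)))\<^sup>2 \<le> (1 - a * \<mu>) * (norm (z - xs))\<^sup>2"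
    and y': "y' = (\<chi> i. closest_point \<Omega> ((mix W y - a *\<^sub>R (\<chi> i. g i (y $ i))) $ i))"
    and \<beta>: "\<beta> = second_eigenvalue_magnitude W"
    and c1: "c1 = 3 * L\<^sup>2 / (1 - \<beta>)" and c2: "c2 = 3 * real CARD('n) * R / (1 - \<beta>)"
    and c4: "c4 = 4 * L\<^sup>2 / \<mu>"
    and A: "A = (norm (stack (agent_mean y) - stack xs :: real ^ 'd ^ 'n))\<^sup>2" and B: "B = (norm (dev y))\<^sup>2"
  shows "(norm (stack (agent_mean y') - stack xs :: real ^ 'd ^ 'n))\<^sup>2
    \<le> (1 - a * \<mu> / 2) * A + ((c1 + L\<^sup>2) * a\<^sup>2 + c4 * a + \<beta>) * B + c1 * a\<^sup>2 * A + c2 * a\<^sup>2"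
proof -
  define d where "d = (\<chi> i. g i (y $ i))"
  define z where "z = agent_mean y"
  define u where "u = (stack (z - xs - a *\<^sub>R (G z - G xs)) :: real ^ 'd ^ 'n)"
  define e where "e = (stack (agent_mean d - G z) :: real ^ 'd ^ 'n)"
  have \<beta>01: "0 \<le> \<beta>" "\<beta> < 1"
    using second_eigenvalue_magnitude_nonneg second_eigenvalue_magnitude_mixing_less_1[OF W] \<beta> by auto
  have z: "z \<in> \<Omega>" using agent_mean_in_convex \<Omega>(1) y unfolding z_def by blast
  have AB: "(norm (y - stack xs))\<^sup>2 = B + A"
    using norm_sq_diff_stack[of y xs] by (simp add: A B stack_diff)
  have A0: "0 \<le> A" by (simp add: A)
  have "(norm (stack (agent_mean y') - stack xs :: real ^ 'd ^ 'n))\<^sup>2 \<le> (norm (y' - stack xs))\<^sup>2"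
    using norm_sq_diff_stack[of y' xs] by (simp add: stack_diff)
  also have "\<dots> \<le> (\<beta> * norm (dev y) + a * norm d)\<^sup>2
      + (norm (stack (z - xs - a *\<^sub>R (agent_mean d - G xs)) :: real ^ 'd ^ 'n))\<^sup>2"
    unfolding \<beta> z_def using distance_step[OF \<Omega> W a y'[folded d_def] fixp] .
  also have "(\<beta> * norm (dev y) + a * norm d)\<^sup>2 \<le> \<beta> * B + (a * norm d)\<^sup>2 / (1 - \<beta>)"
    unfolding B by (rule young_convex_square[OF \<beta>01])
  also have "(a * norm d)\<^sup>2 / (1 - \<beta>) \<le> a\<^sup>2 * (3 * L\<^sup>2 * (B + A) + 3 * (real CARD('n) * R)) / (1 - \<beta>)"
    unfolding power_mult_distrib d_def AB[symmetric] using \<beta>01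
    by (intro divide_right_mono mult_left_mono norm_sq_gradient_bound[OF lip y xs R]) auto
  also have "\<dots> = c1 * a\<^sup>2 * (B + A) + c2 * a\<^sup>2"
    by (simp add: c1 c2 add_divide_distrib algebra_simps)
  also have "(norm (stack (z - xs - a *\<^sub>R (agent_mean d - G xs)) :: real ^ 'd ^ 'n))\<^sup>2
      \<le> (1 - a * \<mu> / 2) * A + (c4 * a + L\<^sup>2 * a\<^sup>2) * B"
  proof -
    have "(norm u)\<^sup>2 = real CARD('n) * (norm (z - xs - a *\<^sub>R (G z - G xs)))\<^sup>2"
      unfolding u_def by (rule norm_sq_stack)
    also have "\<dots> \<le> real CARD('n) * ((1 - a * \<mu>) * (norm (z - xs))\<^sup>2)"
      by (intro mult_left_mono contr z) simp
    also have "\<dots> = (1 - a * \<mu>) * A"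
      by (simp add: A z_def stack_diff[symmetric] norm_sq_stack)
    finally have u: "(norm u)\<^sup>2 \<le> (1 - a * \<mu>) * A" .
    have "agent_mean d - G z = agent_mean (d - (\<chi> i. g i z))"
      by (simp add: G agent_mean_diff)
    then have "norm e \<le> norm (d - (\<chi> i. g i z))"
      unfolding e_def using norm_stack_mean_le by metis
    then have "(norm e)\<^sup>2 \<le> (norm (d - (\<chi> i. g i z)))\<^sup>2" by (simp add: power_mono)
    also have "\<dots> \<le> L\<^sup>2 * (norm (y - stack z))\<^sup>2"
      unfolding d_def by (rule norm_sq_local_gradients_le[OF lip y z])
    finally have e: "(norm e)\<^sup>2 \<le> L\<^sup>2 * B" by (simp add: B dev_def z_def)
    have "z - xs - a *\<^sub>R (agent_mean d - G xs) = (z - xs - a *\<^sub>R (G z - G xs)) - a *\<^sub>R (agent_mean d - G z)"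
      by (simp add: algebra_simps)
    then have "stack (z - xs - a *\<^sub>R (agent_mean d - G xs)) = u - a *\<^sub>R e"
      by (simp only: u_def e_def stack_diff stack_scaleR)
    moreover have "norm (u - a *\<^sub>R e) \<le> norm u + a * norm e"
      using norm_triangle_ineq4[of u "a *\<^sub>R e"] a by simp
    ultimately have "(norm (stack (z - xs - a *\<^sub>R (agent_mean d - G xs)) :: real ^ 'd ^ 'n))\<^sup>2
        \<le> (norm u + a * norm e)\<^sup>2"
      by (simp add: power_mono)
    (* Young's inequality with weights \<mu> / 4 and 4 / \<mu>. *)
    also have "\<dots> \<le> (1 + a * \<mu> / 4) * (norm u)\<^sup>2 + (4 * a / \<mu> + a\<^sup>2) * (norm e)\<^sup>2"
    proof -
      have "(1 + a * \<mu> / 4) * (norm u)\<^sup>2 + (4 * a / \<mu> + a\<^sup>2) * (norm e)\<^sup>2 - (norm u + a * norm e)\<^sup>2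
          = a / (4 * \<mu>) * (\<mu> * norm u - 4 * norm e)\<^sup>2"
        using mu by (simp add: field_simps power2_eq_square)
      also have "\<dots> \<ge> 0" using a mu by simp
      finally show ?thesis by simp
    qed
    also have "\<dots> \<le> (1 + a * \<mu> / 4) * ((1 - a * \<mu>) * A) + (4 * a / \<mu> + a\<^sup>2) * (L\<^sup>2 * B)"
      using a mu by (intro add_mono mult_left_mono u e) auto
    also have "(1 + a * \<mu> / 4) * ((1 - a * \<mu>) * A) \<le> (1 - a * \<mu> / 2) * A"
    proof -
      have "(1 + a * \<mu> / 4) * (1 - a * \<mu>) = 1 - a * \<mu> / 2 - (a * \<mu> / 4 + (a * \<mu>)\<^sup>2 / 4)"
        by (simp add: power2_eq_square field_simps)
      also have "\<dots> \<le> 1 - a * \<mu> / 2"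
        using mult_nonneg_nonneg[of a \<mu>] zero_le_power2[of "a * \<mu>"] a mu by linarith
      finally show ?thesis
        using A0 unfolding mult.assoc[symmetric] by (intro mult_right_mono)
    qed
    also have "(4 * a / \<mu> + a\<^sup>2) * (L\<^sup>2 * B) = (c4 * a + L\<^sup>2 * a\<^sup>2) * B"
      by (simp add: c4 algebra_simps)
    finally show ?thesis by simp
  qed
  finally show ?thesis by (simp add: algebra_simps)
qed

text \<open>
  The parts of the gradients that are normal to the constraint set are lost in the projection, so that the same
  sequence is generated by the tangential parts.
\<close>

lemma dpg_iterates_tangential:
  fixes x :: "nat \<Rightarrow> real ^ 'd ^ 'n::finite"
  assumes it: "dpg_iterates \<Omega> W g \<alpha> x" and \<Omega>: "closed \<Omega>" "convex \<Omega>" "\<Omega> \<noteq> {}"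
    and P: "\<And>u v. v \<in> directions \<Omega> \<Longrightarrow> (u - P u) \<bullet> v = 0"
  shows "dpg_iterates \<Omega> W (\<lambda>i z. P (g i z)) \<alpha> x"
proof -
  have "closest_point \<Omega> (z - \<alpha> t *\<^sub>R u) = closest_point \<Omega> (z - \<alpha> t *\<^sub>R P u)" for z u t
  proof -
    have "- (\<alpha> t *\<^sub>R (u - P u)) \<bullet> v = 0" if "v \<in> directions \<Omega>" for v
      using P[OF that, of u] by simp
    then have "closest_point \<Omega> (z - \<alpha> t *\<^sub>R P u + - (\<alpha> t *\<^sub>R (u - P u)))
        = closest_point \<Omega> (z - \<alpha> t *\<^sub>R P u)"
      by (rule closest_point_add_normal[OF \<Omega>])
    moreover have "z - \<alpha> t *\<^sub>R P u + - (\<alpha> t *\<^sub>R (u - P u)) = z - \<alpha> t *\<^sub>R u"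
      by (simp add: scaleR_diff_right)
    ultimately show ?thesis by (simp only:)
  qed
  then show ?thesis using it by (simp add: dpg_iterates_def)
qed

lemma dpg_iterates_in_set:
  assumes it: "dpg_iterates \<Omega> W g \<alpha> x" and \<Omega>: "closed \<Omega>" "\<Omega> \<noteq> {}"
  shows "x t $ i \<in> \<Omega>"
  using it closest_point_in_set[OF \<Omega>] by (cases t) (auto simp: dpg_iterates_def)

lemma dpg_iterates_Suc:
  assumes "dpg_iterates \<Omega> W g \<alpha> x"
  shows "x (Suc t) = (\<chi> i. closest_point \<Omega> ((mix W (x t) - \<alpha> t *\<^sub>R (\<chi> i. g i (x t $ i))) $ i))"
  using assms by (simp add: dpg_iterates_def vec_eq_iff mix_def)

section \<open>Scalar recursions\<close>

lemma geometric_recursion_bound: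
  fixes b :: "nat \<Rightarrow> real"
  assumes \<beta>: "0 \<le> \<beta>" "\<beta> < 1" and step: "\<And>s. s \<ge> m \<Longrightarrow> b (Suc s) \<le> \<beta> * b s + c"
  shows "b (m + k) \<le> \<beta> ^ k * b m + c * (1 - \<beta> ^ k) / (1 - \<beta>)"
proof (induction k)
  case (Suc k)
  have "b (m + Suc k) \<le> \<beta> * b (m + k) + c"
    using step[of "m + k"] by simp
  also have "\<dots> \<le> \<beta> * (\<beta> ^ k * b m + c * (1 - \<beta> ^ k) / (1 - \<beta>)) + c"
    using Suc \<beta> by (simp add: mult_left_mono)
  also have "\<dots> = \<beta> ^ Suc k * b m + c * (1 - \<beta> ^ Suc k) / (1 - \<beta>)"
    using \<beta> by (simp add: field_simps)
  finally show ?case .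
qed simp

text \<open>
  The geometric recursion is solved on the first and on the second half of the time interval, with the stepsize bounded
  by \<open>\<alpha> 0\<close> and by \<open>\<alpha> (t div 2)\<close>. Solving the recursion for \<open>b\<close> and squaring afterwards is essential: the
  contribution of the first half decays like \<open>\<beta> ^ (t / 2)\<close> and only its square decays like \<open>\<beta> ^ t\<close>.
  The square of the sum produces no factor in front of \<open>(b 0)\<^sup>2\<close>, because the solution is bounded by a
  convex combination of \<open>b 0\<close> and a bound \<open>y\<close> on the accumulated perturbations, with weights \<open>\<beta> ^ t\<close>
  and \<open>1 - \<beta> ^ t\<close>.
\<close>

lemma consensus_recursion_bound:
  fixes b \<alpha> :: "nat \<Rightarrow> real"
  assumes \<beta>: "0 \<le> \<beta>" "\<beta> < 1" and b: "\<And>t. 0 \<le> b t" and D: "0 \<le> D"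
    and step: "\<And>t. b (Suc t) \<le> \<beta> * b t + \<alpha> t * D"
    and \<alpha>: "antimono \<alpha>" "\<And>t. 0 \<le> \<alpha> t"
  shows "(b t)\<^sup>2 \<le> \<beta> ^ t * (b 0)\<^sup>2 + 2 * D\<^sup>2 / (1 - \<beta>)\<^sup>2 * ((\<alpha> 0)\<^sup>2 * \<beta> ^ t + (\<alpha> (t div 2))\<^sup>2)"
proof -
  define m where "m = t div 2"
  define k where "k = t - m"
  define q where "q = \<beta> ^ k"
  define \<theta> where "\<theta> = \<beta> ^ t"
  define y where "y = D / (1 - \<beta>) * (\<alpha> 0 * q + \<alpha> m)"
  have t: "t = m + k" "m \<le> k" "k \<le> t" by (auto simp: m_def k_def)
  have \<theta>: "\<theta> \<le> q" "0 \<le> \<theta>" "q \<le> 1" "0 \<le> q" "q\<^sup>2 \<le> \<theta>"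
    using \<beta> t by (auto simp: \<theta>_def q_def power_mult[symmetric] intro!: power_decreasing power_le_one)
  have y: "0 \<le> y" using D \<beta> \<alpha>(2) \<theta> by (simp add: y_def)
  have "b (0 + m) \<le> \<beta> ^ m * b 0 + \<alpha> 0 * D * (1 - \<beta> ^ m) / (1 - \<beta>)"
  proof (rule geometric_recursion_bound[OF \<beta>])
    show "b (Suc s) \<le> \<beta> * b s + \<alpha> 0 * D" for s
      using step[of s] mult_right_mono[OF antimonoD[OF \<alpha>(1), of 0 s] D] by simp
  qed
  moreover have "b (m + k) \<le> \<beta> ^ k * b m + \<alpha> m * D * (1 - \<beta> ^ k) / (1 - \<beta>)"
  proof (rule geometric_recursion_bound[OF \<beta>])
    show "b (Suc s) \<le> \<beta> * b s + \<alpha> m * D" if "m \<le> s" for s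
      using step[of s] mult_right_mono[OF antimonoD[OF \<alpha>(1), of m s] D] that by simp
  qed
  ultimately have "b t \<le> q * (\<beta> ^ m * b 0 + \<alpha> 0 * D * (1 - \<beta> ^ m) / (1 - \<beta>)) + \<alpha> m * D * (1 - q) / (1 - \<beta>)"
    using \<theta>(4) mult_left_mono[of "b m" _ q] unfolding t(1) q_def by fastforce
  also have "\<dots> = \<theta> * b 0 + q * (\<alpha> 0 * D * (1 - \<beta> ^ m) / (1 - \<beta>)) + \<alpha> m * D * (1 - q) / (1 - \<beta>)"
    by (simp add: \<theta>_def q_def t(1) power_add algebra_simps)
  also have "q * (\<alpha> 0 * D * (1 - \<beta> ^ m) / (1 - \<beta>)) \<le> q * (\<alpha> 0 * D * (1 - q) / (1 - \<beta>))"
    using \<beta> D \<alpha>(2) t \<theta>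
    by (intro mult_left_mono divide_right_mono) (auto simp: q_def intro!: power_decreasing)
  also have "\<theta> * b 0 + q * (\<alpha> 0 * D * (1 - q) / (1 - \<beta>)) + \<alpha> m * D * (1 - q) / (1 - \<beta>)
      = \<theta> * b 0 + (1 - q) * y"
    by (simp add: y_def add_divide_distrib algebra_simps)
  also have "\<dots> \<le> \<theta> * b 0 + (1 - \<theta>) * y"
    using \<theta> y by (simp add: mult_right_mono)
  finally have "(b t)\<^sup>2 \<le> (\<theta> * b 0 + (1 - \<theta>) * y)\<^sup>2"
    using b by (simp add: power_mono)
  also have "\<dots> \<le> \<theta> * (b 0)\<^sup>2 + (1 - \<theta>) * y\<^sup>2"
  proof -
    have "\<theta> * (b 0)\<^sup>2 + (1 - \<theta>) * y\<^sup>2 - (\<theta> * b 0 + (1 - \<theta>) * y)\<^sup>2 = \<theta> * (1 - \<theta>) * (b 0 - y)\<^sup>2"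
      by (simp add: power2_eq_square algebra_simps)
    also have "\<dots> \<ge> 0" using \<theta> by simp
    finally show ?thesis by simp
  qed
  also have "(1 - \<theta>) * y\<^sup>2 \<le> y\<^sup>2"
    using \<theta> by (simp add: mult_left_le_one_le)
  also have "y\<^sup>2 \<le> D\<^sup>2 / (1 - \<beta>)\<^sup>2 * (2 * ((\<alpha> 0)\<^sup>2 * \<theta> + (\<alpha> m)\<^sup>2))"
  proof -
    have "(\<alpha> 0 * q + \<alpha> m)\<^sup>2 \<le> 2 * ((\<alpha> 0)\<^sup>2 * q\<^sup>2 + (\<alpha> m)\<^sup>2)"
      using zero_le_power2[of "\<alpha> 0 * q - \<alpha> m"]
      by (simp add: power2_sum power2_diff power_mult_distrib algebra_simps)
    also have "\<dots> \<le> 2 * ((\<alpha> 0)\<^sup>2 * \<theta> + (\<alpha> m)\<^sup>2)"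
      using \<theta>(5) by (simp add: mult_left_mono)
    finally show ?thesis
      unfolding y_def power_mult_distrib power_divide by (rule mult_left_mono) simp
  qed
  finally show ?thesis
    by (simp add: \<theta>_def m_def algebra_simps)
qed

lemma exponential_unrolling:
  fixes A a c :: "nat \<Rightarrow> real"
  assumes A: "\<And>t. 0 \<le> A t" and step: "\<And>t. A (Suc t) \<le> (1 - a t) * A t + c t"
  shows "A t \<le> exp (- (\<Sum>s<t. a s)) * A 0 + (\<Sum>s<t. exp (- (\<Sum>j = Suc s..<t. a j)) * c s)"
proof (induction t)
  case (Suc t)
  have "A (Suc t) \<le> exp (- a t) * A t + c t"
    using step[of t] mult_right_mono[OF exp_ge_add_one_self[of "- a t"] A[of t]] by simp
  also have "\<dots> \<le> exp (- a t) * (exp (- (\<Sum>s<t. a s)) * A 0 + (\<Sum>s<t. exp (- (\<Sum>j = Suc s..<t. a j)) * c s)) + c t"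
    using Suc by simp
  also have "\<dots> = exp (- (\<Sum>s<Suc t. a s)) * A 0 + (\<Sum>s<Suc t. exp (- (\<Sum>j = Suc s..<Suc t. a j)) * c s)"
  proof -
    have "exp (- a t) * (\<Sum>s<t. exp (- (\<Sum>j = Suc s..<t. a j)) * c s)
        = (\<Sum>s<t. exp (- (\<Sum>j = Suc s..<Suc t. a j)) * c s)"
      unfolding sum_distrib_left
      by (intro sum.cong refl) (simp add: exp_add[symmetric] mult.assoc[symmetric])
    then show ?thesis
      by (simp add: distrib_left exp_add[symmetric] mult.assoc[symmetric])
  qed
  finally show ?case .
qed simp

text \<open>
  The sum without its last term satisfies \<open>S (t + 1) = exp (- a t) * (S t + a t)\<close>, so it stays at most 1
  by \<open>1 + a t \<le> exp (a t)\<close>. For nonnegative \<open>a\<close> it is a lower Riemann sum for the integral of \<open>exp\<close> over the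
  negative half-line.
\<close>

lemma sum_exp_tail_le_2:
  fixes a :: "nat \<Rightarrow> real"
  assumes a: "\<And>j. a j \<le> 1" and "m \<le> t"
  shows "(\<Sum>k = m..t. exp (- (\<Sum>j = k..<t. a j)) * a k) \<le> 2"
proof -
  have "(\<Sum>k = m..<t. exp (- (\<Sum>j = k..<t. a j)) * a k) \<le> 1"
    using \<open>m \<le> t\<close>
  proof (induction t rule: dec_induct)
    case (step t)
    have "(\<Sum>k = m..<Suc t. exp (- (\<Sum>j = k..<Suc t. a j)) * a k)
        = exp (- a t) * ((\<Sum>k = m..<t. exp (- (\<Sum>j = k..<t. a j)) * a k) + a t)"
      using step.hyps unfolding distrib_left sum_distrib_left
      by (simp add: exp_add[symmetric] mult.assoc[symmetric] add.commute cong: sum.cong_simp)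
    also have "\<dots> \<le> exp (- a t) * (1 + a t)"
      using step.IH by simp
    also have "\<dots> \<le> exp (- a t) * exp (a t)"
      by (intro mult_left_mono exp_ge_add_one_self) simp
    finally show ?case by (simp add: exp_add[symmetric])
  qed simp
  moreover have "(\<Sum>k = m..t. exp (- (\<Sum>j = k..<t. a j)) * a k)
      = (\<Sum>k = m..<t. exp (- (\<Sum>j = k..<t. a j)) * a k) + a t"
    using \<open>m \<le> t\<close> by (simp add: sum.last_plus)
  ultimately show ?thesis using a[of t] by simp
qed

text \<open>
  The harmonic sum is at least \<open>ln ((real t + w) / (real k + w))\<close>.
\<close>

lemma exp_harmonic_le_powr:
  fixes w b :: real
  assumes w: "w > 0" and b: "b \<ge> 0" and "k \<le> t"
  shows "exp (- (\<Sum>j = k..<t. b / (real j + w))) \<le> ((real k + w) / (real t + w)) powr b"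
proof -
  have "ln (real t + w) - ln (real k + w) \<le> (\<Sum>j = k..<t. 1 / (real j + w))"
    using \<open>k \<le> t\<close>
  proof (induction t rule: dec_induct)
    case (step t)
    have "ln ((real (Suc t) + w) / (real t + w)) \<le> (real (Suc t) + w) / (real t + w) - 1"
      using w by (intro ln_le_minus_one) (simp add: add_nonneg_pos)
    also have "\<dots> = 1 / (real t + w)"
      using w by (simp add: field_simps)
    finally show ?case
      using step w by (simp add: ln_div add_nonneg_pos)
  qed simp
  then have "b * (ln (real t + w) - ln (real k + w)) \<le> b * (\<Sum>j = k..<t. 1 / (real j + w))"
    using b by (rule mult_left_mono)
  then have "exp (- (\<Sum>j = k..<t. b / (real j + w))) \<le> exp (b * ln ((real k + w) / (real t + w)))"
    using w by (simp add: ln_div add_nonneg_pos sum_distrib_left algebra_simps)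
  then show ?thesis
    using w by (simp add: powr_def)
qed

text \<open>
  By the mean value theorem the increment is \<open>b * z powr (b - 1)\<close> with \<open>z\<close> between \<open>y\<close> and \<open>y + 1\<close>. The factor
  \<open>r powr b\<close> allows for \<open>b > 1\<close>, when the power is largest at the right endpoint. It serves to sum powers
  by telescoping, uniformly in \<open>b\<close>.
\<close>

lemma powr_increment_lower_bound:
  fixes y b r :: real
  assumes y: "y > 0" and b: "b > 0" and r: "r \<ge> 1" "y + 1 \<le> r * y"
  shows "b * (y + 1) powr (b - 1) \<le> r powr b * ((y + 1) powr b - y powr b)"
proof -
  have "\<exists>z. y < z \<and> z < y + 1 \<and> (y + 1) powr b - y powr b = (y + 1 - y) * (b * z powr (b - 1))"
    using y by (intro MVT2) (auto intro!: has_real_derivative_powr)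
  then obtain z where z: "y < z" "z < y + 1" and mvt: "(y + 1) powr b - y powr b = b * z powr (b - 1)"
    by auto
  have "(y + 1) powr (b - 1) \<le> r powr b * z powr (b - 1)"
  proof (cases "b \<ge> 1")
    case True
    have "y + 1 \<le> r * z"
      using r z mult_left_mono[of y z r] by linarith
    then have "(y + 1) powr (b - 1) \<le> (r * z) powr (b - 1)"
      using True y by (intro powr_mono2) auto
    also have "\<dots> = r powr (b - 1) * z powr (b - 1)"
      using r y z by (simp add: powr_mult)
    also have "\<dots> \<le> r powr b * z powr (b - 1)"
      using r by (intro mult_right_mono powr_mono) auto
    finally show ?thesis .
  next
    case False
    then have "(y + 1) powr (b - 1) \<le> z powr (b - 1)"
      using y z by (intro powr_mono2') auto
    also have "\<dots> \<le> r powr b * z powr (b - 1)"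
      using ge_one_powr_ge_zero[OF r(1), of b] b by (simp add: mult_le_cancel_right1)
    finally show ?thesis .
  qed
  then have "b * (y + 1) powr (b - 1) \<le> b * (r powr b * z powr (b - 1))"
    using b by simp
  then show ?thesis by (simp add: mvt mult_ac)
qed

text \<open>
  With \<open>a = \<mu> * v / 2\<close> the perturbation of time \<open>s\<close> is damped by \<open>((real s + w + 1) / (real t + w)) powr a\<close> until time \<open>t\<close>.
  Up to factors independent of \<open>s\<close> the damped perturbations are \<open>(real s + w + 1) powr (a - 2)\<close>, whose sum is of order
  \<open>(real t + w) powr (a - 1)\<close> because of \<open>a > 1\<close>.
\<close>

lemma harmonic_stepsize_rate:
  fixes A :: "nat \<Rightarrow> real"
  assumes A: "\<And>t. 0 \<le> A t" and vw: "v > 0" "w > 0" and K: "K \<ge> 0" and b: "\<mu> * v / 2 > 1"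
    and step: "\<And>t. A (Suc t) \<le> (1 - \<mu> * (v / (real t + w)) / 2) * A t + K * (v / (real t + w))\<^sup>2"
    and t: "real t + w - 1 > 0"
  shows "A t \<le> (w / (real t + w)) powr (\<mu> * v / 2) * A 0
    + ((w + 1) / w)\<^sup>2 / (\<mu> * v / 2 - 1) * ((w + 1) / w) powr (\<mu> * v / 2) * (K * v\<^sup>2 / (real t + w - 1))"
proof -
  define a where "a = \<mu> * v / 2"
  define r where "r = (w + 1) / w"
  have r: "r \<ge> 1" using vw by (simp add: r_def)
  have ra: "real s + w + 1 \<le> r * (real s + w)" for s
    using vw by (simp add: r_def field_simps)
  have pos: "real s + w > 0" for s using vw by simp
  have a: "a > 1" using b by (simp add: a_def)
  have "A t \<le> exp (- (\<Sum>s<t. a / (real s + w))) * A 0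
      + (\<Sum>s<t. exp (- (\<Sum>j = Suc s..<t. a / (real j + w))) * (K * (v / (real s + w))\<^sup>2))"
  proof (rule exponential_unrolling[OF A])
    show "A (Suc t) \<le> (1 - a / (real t + w)) * A t + K * (v / (real t + w))\<^sup>2" for t
      using step[of t] by (simp add: a_def mult.commute)
  qed
  also have "exp (- (\<Sum>s<t. a / (real s + w))) * A 0 \<le> (w / (real t + w)) powr a * A 0"
    using exp_harmonic_le_powr[of w a 0 t] vw a A[of 0] by (intro mult_right_mono) (auto simp: lessThan_atLeast0)
  also have "(\<Sum>s<t. exp (- (\<Sum>j = Suc s..<t. a / (real j + w))) * (K * (v / (real s + w))\<^sup>2))
      \<le> (\<Sum>s<t. (r\<^sup>2 * K * v\<^sup>2 / (real t + w) powr a) * (real s + w + 1) powr (a - 2))"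
  proof (intro sum_mono)
    fix s assume "s \<in> {..<t}"
    then have "exp (- (\<Sum>j = Suc s..<t. a / (real j + w))) \<le> ((real s + w + 1) / (real t + w)) powr a"
      using exp_harmonic_le_powr[of w a "Suc s" t] vw a by (simp add: add_ac)
    then have "exp (- (\<Sum>j = Suc s..<t. a / (real j + w))) * (K * (v / (real s + w))\<^sup>2)
        \<le> ((real s + w + 1) / (real t + w)) powr a * (K * (v * r / (real s + w + 1))\<^sup>2)"
    proof (intro mult_mono power_mono)
      have "1 / (real s + w) \<le> r / (real s + w + 1)"
        using ra[of s] pos[of s] by (simp add: field_simps)
      then show "v / (real s + w) \<le> v * r / (real s + w + 1)"
        using mult_left_mono[of _ _ v] vw by fastforce
    qed (use K vw in auto)
    also have "\<dots> = (r\<^sup>2 * K * v\<^sup>2 / (real t + w) powr a) * ((real s + w + 1) powr a / (real s + w + 1)\<^sup>2)"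
      using pos[of s] pos[of t] by (simp add: powr_divide power_divide power_mult_distrib)
    also have "(real s + w + 1) powr a / (real s + w + 1)\<^sup>2 = (real s + w + 1) powr (a - 2)"
      using pos[of s] by (simp add: powr_diff)
    finally show "exp (- (\<Sum>j = Suc s..<t. a / (real j + w))) * (K * (v / (real s + w))\<^sup>2)
        \<le> (r\<^sup>2 * K * v\<^sup>2 / (real t + w) powr a) * (real s + w + 1) powr (a - 2)" .
  qed
  also have "\<dots> = (r\<^sup>2 * K * v\<^sup>2 / (real t + w) powr a) * (\<Sum>s<t. (real s + w + 1) powr (a - 2))"
    by (simp add: sum_distrib_left)
  also have "\<dots> \<le> (r\<^sup>2 * K * v\<^sup>2 / (real t + w) powr a) * (r powr a / (a - 1) * (real t + w) powr (a - 1))"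
  proof (rule mult_left_mono)
    have "(\<Sum>s<t. (real s + w + 1) powr (a - 2))
        \<le> (\<Sum>s<t. r powr (a - 1) / (a - 1) * ((real (Suc s) + w) powr (a - 1) - (real s + w) powr (a - 1)))"
    proof (intro sum_mono)
      fix s
      have "(a - 1) * (real s + w + 1) powr (a - 1 - 1)
          \<le> r powr (a - 1) * ((real s + w + 1) powr (a - 1) - (real s + w) powr (a - 1))"
        using a by (intro powr_increment_lower_bound pos r ra) simp
      then show "(real s + w + 1) powr (a - 2)
          \<le> r powr (a - 1) / (a - 1) * ((real (Suc s) + w) powr (a - 1) - (real s + w) powr (a - 1))"
        using a by (simp add: field_simps)
    qed
    also have "\<dots> = r powr (a - 1) / (a - 1) * ((real t + w) powr (a - 1) - w powr (a - 1))"
      unfolding sum_distrib_left[symmetric] by (subst sum_lessThan_telescope) simp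
    also have "\<dots> \<le> r powr a / (a - 1) * (real t + w) powr (a - 1)"
      using r a vw powr_mono2[of "a - 1" w "real t + w"]
      by (intro mult_mono divide_right_mono powr_mono) auto
    finally show "(\<Sum>s<t. (real s + w + 1) powr (a - 2)) \<le> r powr a / (a - 1) * (real t + w) powr (a - 1)" .
  qed (use K in simp)
  also have "\<dots> = r\<^sup>2 / (a - 1) * r powr a * (K * v\<^sup>2 / (real t + w))"
    using pos[of t] by (simp add: powr_diff field_simps)
  also have "\<dots> \<le> r\<^sup>2 / (a - 1) * r powr a * (K * v\<^sup>2 / (real t + w - 1))"
    using a K t by (intro mult_left_mono divide_left_mono mult_pos_pos) auto
  finally show ?thesis
    by (simp add: a_def r_def)
qed

text \<open>
  The perturbations of the first half of the time interval are damped exponentially, as the stepsize is at least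
  \<open>\<alpha> t\<close> in the whole second half. For those of the second half one of the two factors \<open>\<alpha> k\<close> is bounded by the
  stepsize just before the midpoint, and the other one makes the sum of the damped terms bounded by \<open>sum_exp_tail_le_2\<close>.
\<close>

lemma polynomial_stepsize_rate:
  fixes A :: "nat \<Rightarrow> real"
  assumes A: "\<And>t. 0 \<le> A t" and vw: "v > 0" "w > 0" and K: "K \<ge> 0" and mu: "\<mu> > 0" and p: "p > 0"
    and \<alpha>: "\<And>t. \<alpha> t = v / (real t + w) powr p" and small: "\<mu> * \<alpha> 0 \<le> 2"
    and step: "\<And>t. A (Suc t) \<le> (1 - \<mu> * \<alpha> t / 2) * A t + K * (\<alpha> t)\<^sup>2"
    and t: "real (t div 2) + w - 1 > 0"
  shows "A t \<le> 2 * exp 1 * ((w + 1) / w) powr (2 * p) * K * v / \<mu> * (real (t div 2) + w - 1) powr (- p)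
    + exp (- (\<Sum>s<t. \<mu> * v / (2 * (real s + w) powr p))) * A 0
    + ((w + 1) / w) powr (2 * p) * K * v\<^sup>2 * exp (- (\<mu> * v * real t / (4 * (real t + w) powr p)))
      * (\<Sum>s = 1..t div 2 - 1. 1 / (real s + w) powr (2 * p))"
proof -
  define a where "a = (\<lambda>t. \<mu> * \<alpha> t / 2)"
  define r where "r = ((w + 1) / w) powr (2 * p)"
  define m where "m = t div 2"
  define E where "E = (\<lambda>k. exp (- (\<Sum>j = k..<t. a j)))"
  define V where "V = v * (real m + w - 1) powr (- p)"
  have pos: "real s + w > 0" for s using vw by simp
  have \<alpha>0: "\<alpha> s > 0" for s unfolding \<alpha> using vw pos[of s] by simp
  have \<alpha>_mono: "\<alpha> k \<le> \<alpha> s" if "s \<le> k" for s k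
    unfolding \<alpha> using vw p that by (intro divide_left_mono powr_mono2 mult_pos_pos) auto
  have a1: "a j \<le> 1" for j
    using order.trans[OF mult_left_mono[OF \<alpha>_mono[of 0 j], of \<mu>] small] mu by (simp add: a_def)
  have r: "r \<ge> 0" by (simp add: r_def)
  have \<alpha>sq: "(\<alpha> s)\<^sup>2 = v\<^sup>2 * (1 / (real s + w) powr (2 * p))" for s
    unfolding \<alpha> by (simp add: power_divide powr_powr[symmetric] powr_realpow[symmetric] pos powr_power mult.commute)
  have shift: "(\<alpha> s)\<^sup>2 \<le> r * (\<alpha> (Suc s))\<^sup>2" for s
  proof -
    have "(real (Suc s) + w) \<le> (w + 1) / w * (real s + w)"
      using vw by (simp add: field_simps)
    then have "(real (Suc s) + w) powr (2 * p) \<le> r * (real s + w) powr (2 * p)"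
      using powr_mono2[of "2 * p" "real (Suc s) + w" "(w + 1) / w * (real s + w)"] p vw
        powr_mult[of "(w + 1) / w" "real s + w" "2 * p"] by (simp del: times_divide_eq_left add: r_def)
    then show ?thesis
      unfolding \<alpha>sq using vw pos[of s] pos[of "Suc s"] by (simp add: field_simps)
  qed
  have "A t \<le> exp (- (\<Sum>s<t. a s)) * A 0 + (\<Sum>s<t. E (Suc s) * (K * (\<alpha> s)\<^sup>2))"
    unfolding E_def
  proof (rule exponential_unrolling[OF A])
    show "A (Suc t) \<le> (1 - a t) * A t + K * (\<alpha> t)\<^sup>2" for t
      using step[of t] by (simp add: a_def)
  qed
  (* The damping of the perturbation at time s starts at time s + 1. Passing to the stepsize of
     that time costs the factor r and aligns the two indices. *)
  also have "(\<Sum>s<t. E (Suc s) * (K * (\<alpha> s)\<^sup>2)) \<le> (\<Sum>s<t. E (Suc s) * (K * (r * (\<alpha> (Suc s))\<^sup>2)))"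
    using K shift by (intro sum_mono mult_left_mono) (auto simp: E_def)
  also have "\<dots> = r * K * (\<Sum>k = 1..t. E k * (\<alpha> k)\<^sup>2)"
    unfolding sum_distrib_left
    by (rule sum.reindex_bij_witness[of _ "\<lambda>k. k - 1" Suc]) auto
  also have "(\<Sum>k = 1..t. E k * (\<alpha> k)\<^sup>2)
      \<le> (\<Sum>k = 1..m - 1. E k * (\<alpha> k)\<^sup>2) + (\<Sum>k = m..t. E k * (\<alpha> k)\<^sup>2)"
  proof -
    have "m - 1 \<le> t" "{1..t} \<subseteq> {1..m - 1} \<union> {m..t}" by (auto simp: m_def)
    then have "(\<Sum>k = 1..t. E k * (\<alpha> k)\<^sup>2) \<le> (\<Sum>k \<in> {1..m - 1} \<union> {m..t}. E k * (\<alpha> k)\<^sup>2)"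
      by (intro sum_mono2) (auto simp: E_def)
    also have "\<dots> = (\<Sum>k = 1..m - 1. E k * (\<alpha> k)\<^sup>2) + (\<Sum>k = m..t. E k * (\<alpha> k)\<^sup>2)"
      by (rule sum.union_disjoint) auto
    finally show ?thesis .
  qed
  also have "(\<Sum>k = 1..m - 1. E k * (\<alpha> k)\<^sup>2)
      \<le> v\<^sup>2 * exp (- (\<mu> * v * real t / (4 * (real t + w) powr p))) * (\<Sum>s = 1..m - 1. 1 / (real s + w) powr (2 * p))"
    unfolding sum_distrib_left
  proof (intro sum_mono)
    fix k assume k: "k \<in> {1..m - 1}"
    then have kt: "real t / 2 \<le> real (t - k)" by (auto simp: m_def)
    have "real t / 2 * a t \<le> real (t - k) * a t"
      using kt \<alpha>0[of t] mu by (intro mult_right_mono) (auto simp: a_def less_imp_le)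
    also have "\<dots> = (\<Sum>j = k..<t. a t)" by simp
    also have "\<dots> \<le> (\<Sum>j = k..<t. a j)"
      using \<alpha>_mono mu by (intro sum_mono) (auto simp: a_def)
    finally have "E k \<le> exp (- (\<mu> * v * real t / (4 * (real t + w) powr p)))"
      by (simp add: E_def a_def \<alpha> field_simps)
    then have "E k * (\<alpha> k)\<^sup>2 \<le> exp (- (\<mu> * v * real t / (4 * (real t + w) powr p))) * (\<alpha> k)\<^sup>2"
      by (rule mult_right_mono) simp
    then show "E k * (\<alpha> k)\<^sup>2
        \<le> v\<^sup>2 * exp (- (\<mu> * v * real t / (4 * (real t + w) powr p))) * (1 / (real k + w) powr (2 * p))"
      by (simp add: \<alpha>sq mult_ac)
  qed
  also have "(\<Sum>k = m..t. E k * (\<alpha> k)\<^sup>2) \<le> 2 * exp 1 / \<mu> * V"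
  proof -
    have V: "\<alpha> k \<le> V" if "m \<le> k" for k
    proof -
      have "(real m + w - 1) powr p \<le> (real k + w) powr p"
        using t that p by (intro powr_mono2) (auto simp: m_def)
      then show ?thesis
        unfolding \<alpha> V_def powr_minus using t vw by (auto simp: m_def divide_inverse intro!: le_imp_inverse_le)
    qed
    have "(\<Sum>k = m..t. E k * (\<alpha> k)\<^sup>2) \<le> (\<Sum>k = m..t. 2 / \<mu> * V * (E k * a k))"
    proof (intro sum_mono)
      fix k assume "k \<in> {m..t}"
      then have "E k * \<alpha> k * \<alpha> k \<le> E k * \<alpha> k * V"
        using V \<alpha>0[of k] by (intro mult_left_mono) (auto simp: E_def)
      then show "E k * (\<alpha> k)\<^sup>2 \<le> 2 / \<mu> * V * (E k * a k)"
        using mu by (simp add: a_def power2_eq_square mult_ac)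
    qed
    also have "\<dots> = 2 / \<mu> * V * (\<Sum>k = m..t. E k * a k)"
      by (simp add: sum_distrib_left)
    also have "\<dots> \<le> 2 / \<mu> * V * exp 1"
    proof (rule mult_left_mono)
      have "(\<Sum>k = m..t. E k * a k) \<le> 2"
        unfolding E_def using a1 by (intro sum_exp_tail_le_2) (auto simp: m_def)
      also have "2 \<le> exp (1::real)" using exp_ge_add_one_self[of 1] by simp
      finally show "(\<Sum>k = m..t. E k * a k) \<le> exp 1" .
    qed (use mu vw in \<open>simp add: V_def\<close>)
    finally show ?thesis by (simp add: mult_ac)
  qed
  finally have "A t \<le> exp (- (\<Sum>s<t. a s)) * A 0 + r * K *
      (v\<^sup>2 * exp (- (\<mu> * v * real t / (4 * (real t + w) powr p))) * (\<Sum>s = 1..m - 1. 1 / (real s + w) powr (2 * p))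
        + 2 * exp 1 / \<mu> * V)"
    using r K by (simp add: mult_left_mono)
  then show ?thesis
    by (simp add: a_def \<alpha> r_def m_def V_def algebra_simps)
qed

section \<open>Finiteness of the suprema\<close>

text \<open>
  The supremum of an unbounded family of reals is an unspecified value, so it bounds the family only if there is some
  bound. Here geometric decay beats the polynomial growth of the inverse squared stepsize.
\<close>

lemma bdd_above_geometric_over_stepsize:
  assumes \<beta>: "0 \<le> \<beta>" "\<beta> < 1" and vw: "v > 0" "w > 0"
    and \<alpha>: "\<And>t. \<alpha> t = v / (real t + w) powr p"
  shows "bdd_above (range (\<lambda>t::nat. \<beta> ^ t / (\<alpha> t)\<^sup>2))"
proof -
  (* A positive ratio, since \<beta> = 0 is possible. *)
  define \<gamma> where "\<gamma> = max \<beta> (1 / 2)"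
  have \<gamma>: "0 < \<gamma>" "\<gamma> < 1" "\<beta> \<le> \<gamma>" using \<beta> by (auto simp: \<gamma>_def)
  have "(\<lambda>t. \<gamma> ^ t * ((real t + w) powr p / v)\<^sup>2) \<longlonglongrightarrow> 0"
    using \<gamma> vw by real_asymp
  then have "Bseq (\<lambda>t. \<gamma> ^ t * ((real t + w) powr p / v)\<^sup>2)"
    by (intro convergent_imp_Bseq convergentI)
  then obtain C where C: "\<And>t. norm (\<gamma> ^ t * ((real t + w) powr p / v)\<^sup>2) \<le> C"
    unfolding Bseq_def by blast
  have "\<beta> ^ t / (\<alpha> t)\<^sup>2 \<le> C" for t
  proof -
    have "\<beta> ^ t / (\<alpha> t)\<^sup>2 = \<beta> ^ t * ((real t + w) powr p / v)\<^sup>2"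
      by (simp add: \<alpha> power_divide)
    also have "\<dots> \<le> \<gamma> ^ t * ((real t + w) powr p / v)\<^sup>2"
      using \<beta> \<gamma> by (intro mult_right_mono power_mono) auto
    finally show ?thesis using C[of t] by simp
  qed
  then show ?thesis by (auto simp: bdd_above_def)
qed

text \<open>
  Halving the time changes the stepsize by a bounded factor, as \<open>real s + w \<le> (2 + 1 / w) * (real (s div 2) + w)\<close>.
\<close>

lemma bdd_above_consensus_ratio:
  assumes \<beta>: "0 \<le> \<beta>" "\<beta> < 1" and vw: "v > 0" "w > 0" and p: "p > 0"
    and \<alpha>: "\<And>t. \<alpha> t = v / (real t + w) powr p"
  shows "bdd_above (range (\<lambda>s::nat. ((\<alpha> 0)\<^sup>2 * \<beta> ^ s + (\<alpha> (s div 2))\<^sup>2) / (\<alpha> s)\<^sup>2))"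
proof -
  obtain C where C: "\<And>t. \<beta> ^ t / (\<alpha> t)\<^sup>2 \<le> C"
    using bdd_above_geometric_over_stepsize[OF \<beta> vw \<alpha>] by (auto simp: bdd_above_def)
  have pos: "real s + w > 0" for s :: nat using vw by simp
  have "\<alpha> (s div 2) / \<alpha> s \<le> (2 + 1 / w) powr p" for s
  proof -
    have "real s \<le> 2 * real (s div 2) + 1" by linarith
    moreover have "1 \<le> 1 / w * (real (s div 2) + w)" using vw by (simp add: field_simps)
    then have "w + 1 \<le> 2 * w + 1 / w * (real (s div 2) + w)"
      using vw by (intro add_mono) auto
    ultimately have "real s + w \<le> 2 * (real (s div 2) + w) + 1 / w * (real (s div 2) + w)"
      by (simp only: distrib_left[of 2])
    then have "real s + w \<le> (2 + 1 / w) * (real (s div 2) + w)"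
      by (simp only: distrib_right)
    then have "(real s + w) powr p \<le> (2 + 1 / w) powr p * (real (s div 2) + w) powr p"
      using powr_mono2[of p "real s + w" "(2 + 1 / w) * (real (s div 2) + w)"] p vw
      by (simp add: powr_mult)
    then show ?thesis
      unfolding \<alpha> using vw pos[of s] pos[of "s div 2"] by (simp add: field_simps)
  qed
  moreover have "0 \<le> \<alpha> s" for s unfolding \<alpha> using vw by simp
  ultimately have "(\<alpha> (s div 2) / \<alpha> s)\<^sup>2 \<le> ((2 + 1 / w) powr p)\<^sup>2" for s
    by (intro power_mono) auto
  moreover have "(\<alpha> 0)\<^sup>2 * (\<beta> ^ s / (\<alpha> s)\<^sup>2) \<le> (\<alpha> 0)\<^sup>2 * C" for s
    using C by (intro mult_left_mono) auto
  ultimately have "((\<alpha> 0)\<^sup>2 * \<beta> ^ s + (\<alpha> (s div 2))\<^sup>2) / (\<alpha> s)\<^sup>2 \<le> (\<alpha> 0)\<^sup>2 * C + ((2 + 1 / w) powr p)\<^sup>2" for s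
    by (simp add: add_divide_distrib power_divide add_mono)
  then show ?thesis by (auto simp: bdd_above_def)
qed

section \<open>Convergence rates\<close>

theorem theorem2p12:
  fixes \<Omega> :: "(real ^ 'd) set"
    and fi :: "'n::finite \<Rightarrow> real ^ 'd \<Rightarrow> real"
    and gradf :: "'n \<Rightarrow> real ^ 'd \<Rightarrow> real ^ 'd"
    and f :: "real ^ 'd \<Rightarrow> real"
    and grad :: "real ^ 'd \<Rightarrow> real ^ 'd"
    and E :: "'n set set"
    and W :: "real ^ 'n ^ 'n"
    and x :: "nat \<Rightarrow> real ^ 'd ^ 'n"
    and xbar :: "nat \<Rightarrow> real ^ 'd ^ 'n"
    and xs :: "real ^ 'd"
    and xstar :: "real ^ 'd ^ 'n"
    and \<alpha> :: "nat \<Rightarrow> real"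
    and n :: nat
    and L \<mu> \<beta> R\<^sub>D R\<^sub>s p v w c\<^sub>1 c\<^sub>2 c\<^sub>3 c\<^sub>4 R\<^sub>c G\<^sub>3 G\<^sub>4 \<rho>\<^sub>1 \<rho>\<^sub>2 :: real
  assumes n: "n = CARD('n)"
    and Omega: "\<Omega> \<noteq> {}" "closed \<Omega>" "convex \<Omega>"
    and gradf: "\<And>i. gradient_on \<Omega> (fi i) (gradf i)"
    and f: "f = (\<lambda>z. (1 / real n) * (\<Sum>i\<in>UNIV. fi i z))"
    and grad: "grad = (\<lambda>z. (1 / real n) *\<^sub>R (\<Sum>i\<in>UNIV. gradf i z))"
    and L: "L > 0" and smooth: "\<And>i. L-lipschitz_on \<Omega> (gradf i)"
    and mu: "\<mu> > 0" and strong: "strongly_convex_on \<mu> \<Omega> f grad"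
    and minimizer: "is_arg_min f (\<lambda>z. z \<in> \<Omega>) xs"
    and graph: "undirected_graph E" "connected_graph E"
    and mixing: "mixing_matrix E W"
    and beta: "\<beta> = second_eigenvalue_magnitude W"
    and iterates: "dpg_iterates \<Omega> W gradf \<alpha> x"
    and xbar: "xbar = (\<lambda>t. stack (agent_mean (x t)))"
    and xstar: "xstar = stack xs"
    and Rs: "R\<^sub>s > 0" and bounded: "\<And>t. (norm (x t - xstar))\<^sup>2 \<le> R\<^sub>s"
    and p: "0 < p" "p \<le> 1"
    and vw: "v > 0" "w > 0"
    and alpha: "\<alpha> = (\<lambda>t. v / (real t + w) powr p)"
    and alpha0: "\<alpha> 0 \<le> 2 / (L + \<mu>)"
    and RD: "R\<^sub>D = (MAX i. (norm (gradf i xs))\<^sup>2)"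
    and c1: "c\<^sub>1 = 3 * L\<^sup>2 / (1 - \<beta>)"
    and c2: "c\<^sub>2 = 3 * real n * R\<^sub>D / (1 - \<beta>)"
    and c3: "c\<^sub>3 = c\<^sub>1 + L\<^sup>2"
    and c4: "c\<^sub>4 = 4 * L\<^sup>2 / \<mu>"
    and Rc: "R\<^sub>c = 3 * (L\<^sup>2 * R\<^sub>s + real n * R\<^sub>D) *
               (SUP s. ((\<alpha> 0)\<^sup>2 * \<beta> ^ s + (\<alpha> (s div 2))\<^sup>2) / (\<alpha> s)\<^sup>2)"
    and G3: "G\<^sub>3 = (c\<^sub>3 * (\<alpha> 0)\<^sup>2 + c\<^sub>4 * \<alpha> 0 + \<beta>) * R\<^sub>s"
    and G4: "G\<^sub>4 = (c\<^sub>3 * (\<alpha> 0)\<^sup>2 + c\<^sub>4 * \<alpha> 0 + \<beta>) * (2 * R\<^sub>c / (1 - \<beta>)\<^sup>2) + c\<^sub>1 * R\<^sub>s + c\<^sub>2"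
    and rho1: "\<rho>\<^sub>1 = ((w + 1) / w) powr (2 * p)"
    and rho2: "\<rho>\<^sub>2 = (SUP t. \<beta> ^ t / (\<alpha> t)\<^sup>2)"
  shows
    "(p < 1 \<longrightarrow>
       (\<forall>t::nat. real (t div 2) + w - 1 > 0 \<longrightarrow>
          (norm (xbar t - xstar))\<^sup>2
            \<le> 2 * exp 1 * \<rho>\<^sub>1 * (\<rho>\<^sub>2 * G\<^sub>3 + G\<^sub>4) * v / \<mu> * (real (t div 2) + w - 1) powr (- p)
              + exp (- (\<Sum>s<t. \<mu> * v / (2 * (real s + w) powr p))) * (norm (xbar 0 - xstar))\<^sup>2
              + \<rho>\<^sub>1 * (\<rho>\<^sub>2 * G\<^sub>3 + G\<^sub>4) * v\<^sup>2 * exp (- (\<mu> * v * real t / (4 * (real t + w) powr p)))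
                * (\<Sum>s = 1..t div 2 - 1. 1 / (real s + w) powr (2 * p)))) \<and>
     (p = 1 \<longrightarrow> \<mu> * v / 2 > 1 \<longrightarrow>
       (\<forall>t::nat. real t + w - 1 > 0 \<longrightarrow>
          (norm (xbar t - xstar))\<^sup>2
            \<le> (w / (real t + w)) powr (\<mu> * v / 2) * (norm (xbar 0 - xstar))\<^sup>2
              + \<rho>\<^sub>1 / (\<mu> * v / 2 - 1) * ((w + 1) / w) powr (\<mu> * v / 2)
                * ((\<rho>\<^sub>2 * G\<^sub>3 + G\<^sub>4) * v\<^sup>2 / (real t + w - 1))))"
proof -
  obtain P where P: "linear P" "\<And>u. P u \<in> directions \<Omega>"
    "\<And>u v. v \<in> directions \<Omega> \<Longrightarrow> (u - P u) \<bullet> v = 0" "\<And>u. norm (P u) \<le> norm u"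
    using obtain_orthogonal_projection[OF subspace_directions[of \<Omega>]] by blast
  (* From here on the tangential gradients g i replace the given ones. *)
  define g where "g = (\<lambda>i z. P (gradf i z))"
  define G where "G = (\<lambda>z. agent_mean (\<chi> i. g i z))"
  note \<Omega> = Omega(3,2,1)
  have it: "dpg_iterates \<Omega> W g \<alpha> x"
    unfolding g_def using dpg_iterates_tangential[OF iterates Omega(2,3,1)] P(3) by blast
  have x\<Omega>: "x t $ i \<in> \<Omega>" for t i
    by (rule dpg_iterates_in_set[OF it Omega(2,1)])
  have xs: "xs \<in> \<Omega>" using minimizer by (simp add: is_arg_min_def)
  have grad_f: "gradient_on \<Omega> f grad"
    unfolding f grad by (rule gradient_on_average[OF gradf])
  have lip_grad: "L-lipschitz_on \<Omega> grad"
    unfolding grad n by (rule lipschitz_on_average[OF smooth])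
  have lip: "L-lipschitz_on \<Omega> (g i)" for i
  proof (rule lipschitz_onI)
    fix y z assume "y \<in> \<Omega>" "z \<in> \<Omega>"
    then show "dist (g i y) (g i z) \<le> L * dist y z"
      using order.trans[OF P(4)[of "gradf i y - gradf i z"]] lipschitz_onD[OF smooth, of y z]
      by (simp add: g_def dist_norm linear_diff[OF P(1)])
  qed (use L in simp)
  have GP: "G z = P (grad z)" for z
    by (simp add: G_def g_def grad n agent_mean_def linear_scale[OF P(1)] linear_sum[OF P(1)])
  have R: "(norm (g i xs))\<^sup>2 \<le> R\<^sub>D" for i
  proof -
    have "(norm (g i xs))\<^sup>2 \<le> (norm (gradf i xs))\<^sup>2"
      using P(4) by (simp add: g_def power_mono)
    also have "\<dots> \<le> R\<^sub>D" unfolding RD by (rule Max_ge) auto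
    finally show ?thesis .
  qed
  have RD0: "0 \<le> R\<^sub>D" using order.trans[OF zero_le_power2 R] .
  have \<beta>: "0 \<le> \<beta>" "\<beta> < 1"
    using second_eigenvalue_magnitude_nonneg second_eigenvalue_magnitude_mixing_less_1[OF mixing] beta by auto
  have pos: "real t + w > 0" for t :: nat using vw by simp
  have \<alpha>0: "\<alpha> t > 0" for t using vw pos[of t] by (simp add: alpha)
  have \<alpha>_anti: "antimono \<alpha>"
    unfolding alpha using vw p by (intro antimonoI divide_left_mono powr_mono2 mult_pos_pos) auto
  have \<alpha>le: "\<alpha> t \<le> \<alpha> 0" for t using antimonoD[OF \<alpha>_anti] by simp
  have fixp: "closest_point \<Omega> (xs - \<alpha> t *\<^sub>R G xs) = xs" for t
  proof -
    have "closest_point \<Omega> (xs - \<alpha> t *\<^sub>R grad xs + \<alpha> t *\<^sub>R (grad xs - P (grad xs))) = xs"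
      using closest_point_add_normal[OF Omega(2,3,1), of "\<alpha> t *\<^sub>R (grad xs - P (grad xs))"] P(3)
        minimizer_projected_fixpoint[OF Omega(3,2) grad_f minimizer less_imp_le[OF \<alpha>0[of t]]] by simp
    then show ?thesis by (simp add: GP algebra_simps)
  qed
  have contr: "(norm (z - xs - \<alpha> t *\<^sub>R (G z - G xs)))\<^sup>2 \<le> (1 - \<alpha> t * \<mu>) * (norm (z - xs))\<^sup>2"
    if "z \<in> \<Omega>" for z t
    unfolding GP using \<alpha>0[of t] \<alpha>le[of t] alpha0
    by (intro gradient_step_contraction[OF Omega(3) grad_f lip_grad strong mu P _ _ that xs]) auto
  define A where "A = (\<lambda>t. (norm (xbar t - xstar))\<^sup>2)"
  define B where "B = (\<lambda>t. (norm (dev (x t)))\<^sup>2)"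
  have AB: "(norm (x t - xstar))\<^sup>2 = B t + A t" for t
    using norm_sq_diff_stack[of "x t" xs] by (simp add: A_def B_def xbar xstar stack_diff)
  have A0: "0 \<le> A t" and B0: "0 \<le> B t" for t by (auto simp: A_def B_def)
  have ABle: "A t \<le> R\<^sub>s" "B t \<le> R\<^sub>s" for t
    using bounded[of t] A0[of t] B0[of t] by (auto simp: AB)
  have stepA: "A (Suc t) \<le> (1 - \<alpha> t * \<mu> / 2) * A t + ((c\<^sub>1 + L\<^sup>2) * (\<alpha> t)\<^sup>2 + c\<^sub>4 * \<alpha> t + \<beta>) * B t
      + c\<^sub>1 * (\<alpha> t)\<^sup>2 * A t + c\<^sub>2 * (\<alpha> t)\<^sup>2" for t
    unfolding A_def xbar xstar
    by (rule mean_error_step[OF \<Omega> mixing lip mu less_imp_le[OF \<alpha>0] x\<Omega> xs R _ fixp contr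
          dpg_iterates_Suc[OF it] beta c1 c2[unfolded n] c4 refl])
      (simp_all add: G_def B_def)
  define D where "D = sqrt (3 * (L\<^sup>2 * R\<^sub>s + real n * R\<^sub>D))"
  define S where "S = (SUP s. ((\<alpha> 0)\<^sup>2 * \<beta> ^ s + (\<alpha> (s div 2))\<^sup>2) / (\<alpha> s)\<^sup>2)"
  have D2: "D\<^sup>2 = 3 * (L\<^sup>2 * R\<^sub>s + real n * R\<^sub>D)" "0 \<le> D"
    using Rs RD0 by (auto simp: D_def)
  have grad_le: "norm (\<chi> i. g i (x t $ i)) \<le> D" for t
  proof (rule power2_le_imp_le)
    have "(norm (\<chi> i. g i (x t $ i)))\<^sup>2 \<le> 3 * L\<^sup>2 * (norm (x t - stack xs))\<^sup>2 + 3 * (real CARD('n) * R\<^sub>D)"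
      by (rule norm_sq_gradient_bound[OF lip x\<Omega> xs R])
    also have "\<dots> \<le> 3 * L\<^sup>2 * R\<^sub>s + 3 * (real CARD('n) * R\<^sub>D)"
      using bounded[of t] by (simp add: xstar mult_left_mono)
    finally show "(norm (\<chi> i. g i (x t $ i)))\<^sup>2 \<le> D\<^sup>2"
      by (simp add: D2 n algebra_simps)
  qed (rule D2)
  have S_upper: "((\<alpha> 0)\<^sup>2 * \<beta> ^ t + (\<alpha> (t div 2))\<^sup>2) / (\<alpha> t)\<^sup>2 \<le> S" for t
    unfolding S_def using bdd_above_consensus_ratio[OF \<beta> vw p(1), of \<alpha>]
    by (intro cSUP_upper) (auto simp: alpha)
  have stepB: "norm (dev (x (Suc t))) \<le> \<beta> * norm (dev (x t)) + \<alpha> t * D" for t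
    using consensus_error_step[OF \<Omega> mixing x\<Omega> less_imp_le[OF \<alpha>0] dpg_iterates_Suc[OF it], of t]
      mult_left_mono[OF grad_le[of t] less_imp_le[OF \<alpha>0[of t]]] by (simp add: beta)
  have Bbound: "B t \<le> \<beta> ^ t * R\<^sub>s + 2 * R\<^sub>c / (1 - \<beta>)\<^sup>2 * (\<alpha> t)\<^sup>2" for t
  proof -
    have "B t \<le> \<beta> ^ t * B 0 + 2 * D\<^sup>2 / (1 - \<beta>)\<^sup>2 * ((\<alpha> 0)\<^sup>2 * \<beta> ^ t + (\<alpha> (t div 2))\<^sup>2)"
      unfolding B_def
      by (rule consensus_recursion_bound[OF \<beta> norm_ge_zero D2(2) stepB \<alpha>_anti less_imp_le[OF \<alpha>0]])
    also have "\<dots> \<le> \<beta> ^ t * R\<^sub>s + 2 * D\<^sup>2 / (1 - \<beta>)\<^sup>2 * (S * (\<alpha> t)\<^sup>2)"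
      using S_upper[of t] \<alpha>0[of t] ABle(2)[of 0] \<beta>
      by (intro add_mono mult_left_mono) (auto simp: field_simps)
    also have "2 * D\<^sup>2 / (1 - \<beta>)\<^sup>2 * (S * (\<alpha> t)\<^sup>2) = 2 * R\<^sub>c / (1 - \<beta>)\<^sup>2 * (\<alpha> t)\<^sup>2"
      by (simp only: Rc S_def D2) (simp add: mult.assoc)
    finally show ?thesis .
  qed
  define K where "K = \<rho>\<^sub>2 * G\<^sub>3 + G\<^sub>4"
  (* K is the coefficient of the squared stepsize in the scalar recursion for A; Q bounds the
     coefficient of the consensus error in it. *)
  define Q where "Q = c\<^sub>3 * (\<alpha> 0)\<^sup>2 + c\<^sub>4 * \<alpha> 0 + \<beta>"
  have c0: "0 \<le> c\<^sub>1" "0 \<le> c\<^sub>2" "0 \<le> c\<^sub>3" "0 \<le> c\<^sub>4"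
    using \<beta> mu RD0 by (auto simp: c1 c2 c3 c4)
  have Q0: "0 \<le> Q" using c0 \<beta> \<alpha>0[of 0] by (simp add: Q_def)
  have S0: "0 \<le> S" using order.trans[OF _ S_upper[of 0]] \<beta> by simp
  have Rc0: "0 \<le> R\<^sub>c" unfolding Rc S_def[symmetric] using S0 Rs RD0 by simp
  have \<rho>2: "\<beta> ^ t / (\<alpha> t)\<^sup>2 \<le> \<rho>\<^sub>2" for t
    unfolding rho2 using bdd_above_geometric_over_stepsize[OF \<beta> vw, of \<alpha> p]
    by (intro cSUP_upper) (auto simp: alpha)
  have \<rho>20: "0 \<le> \<rho>\<^sub>2" using order.trans[OF _ \<rho>2[of 0]] \<beta> by simp
  have G30: "0 \<le> G\<^sub>3" unfolding G3 Q_def[symmetric] using Q0 Rs by simp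
  have K0: "0 \<le> K"
    unfolding K_def G4 Q_def[symmetric] using \<rho>20 G30 Q0 Rc0 c0 Rs by simp
  have step: "A (Suc t) \<le> (1 - \<mu> * \<alpha> t / 2) * A t + K * (\<alpha> t)\<^sup>2" for t
  proof -
    have "(c\<^sub>1 + L\<^sup>2) * (\<alpha> t)\<^sup>2 + c\<^sub>4 * \<alpha> t + \<beta> \<le> Q"
      unfolding Q_def c3 using c0 \<alpha>le[of t] \<alpha>0[of t]
      by (intro add_mono mult_left_mono power_mono) auto
    then have "((c\<^sub>1 + L\<^sup>2) * (\<alpha> t)\<^sup>2 + c\<^sub>4 * \<alpha> t + \<beta>) * B t
        \<le> Q * (\<beta> ^ t * R\<^sub>s + 2 * R\<^sub>c / (1 - \<beta>)\<^sup>2 * (\<alpha> t)\<^sup>2)"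
      using Bbound Q0 B0 by (intro mult_mono) auto
    also have "\<dots> = \<beta> ^ t * G\<^sub>3 + Q * (2 * R\<^sub>c / (1 - \<beta>)\<^sup>2) * (\<alpha> t)\<^sup>2"
      unfolding G3 Q_def[symmetric] by (simp add: distrib_left mult_ac)
    also have "\<beta> ^ t * G\<^sub>3 \<le> \<rho>\<^sub>2 * G\<^sub>3 * (\<alpha> t)\<^sup>2"
    proof -
      have "\<beta> ^ t \<le> \<rho>\<^sub>2 * (\<alpha> t)\<^sup>2"
        using \<rho>2[of t] \<alpha>0[of t] by (simp add: pos_divide_le_eq)
      then have "\<beta> ^ t * G\<^sub>3 \<le> \<rho>\<^sub>2 * (\<alpha> t)\<^sup>2 * G\<^sub>3"
        using G30 by (rule mult_right_mono)
      then show ?thesis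
        by (simp only: mult_ac)
    qed
    finally have 1: "((c\<^sub>1 + L\<^sup>2) * (\<alpha> t)\<^sup>2 + c\<^sub>4 * \<alpha> t + \<beta>) * B t
        \<le> \<rho>\<^sub>2 * G\<^sub>3 * (\<alpha> t)\<^sup>2 + Q * (2 * R\<^sub>c / (1 - \<beta>)\<^sup>2) * (\<alpha> t)\<^sup>2" by simp
    have 2: "c\<^sub>1 * (\<alpha> t)\<^sup>2 * A t \<le> c\<^sub>1 * (\<alpha> t)\<^sup>2 * R\<^sub>s"
      using c0 ABle(1)[of t] by (intro mult_left_mono) auto
    have "K * (\<alpha> t)\<^sup>2 = \<rho>\<^sub>2 * G\<^sub>3 * (\<alpha> t)\<^sup>2 + Q * (2 * R\<^sub>c / (1 - \<beta>)\<^sup>2) * (\<alpha> t)\<^sup>2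
        + c\<^sub>1 * (\<alpha> t)\<^sup>2 * R\<^sub>s + c\<^sub>2 * (\<alpha> t)\<^sup>2"
      unfolding K_def G4 Q_def[symmetric] by (simp add: distrib_right distrib_left mult_ac)
    then show ?thesis
      using stepA[of t] 1 2 unfolding mult.commute[of "\<alpha> t" \<mu>] by linarith
  qed
  show ?thesis
    unfolding A_def[THEN fun_cong, symmetric] K_def[symmetric]
  proof (intro conjI impI allI)
    fix t :: nat
    assume "p < 1" and t: "real (t div 2) + w - 1 > 0"
    show "A t \<le> 2 * exp 1 * \<rho>\<^sub>1 * K * v / \<mu> * (real (t div 2) + w - 1) powr (- p)
        + exp (- (\<Sum>s<t. \<mu> * v / (2 * (real s + w) powr p))) * A 0
        + \<rho>\<^sub>1 * K * v\<^sup>2 * exp (- (\<mu> * v * real t / (4 * (real t + w) powr p)))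
          * (\<Sum>s = 1..t div 2 - 1. 1 / (real s + w) powr (2 * p))"
      unfolding rho1
    proof (rule polynomial_stepsize_rate[where A = A and \<alpha> = \<alpha> and t = t, OF A0 vw K0 mu p(1) _ _ step t])
      show "\<alpha> t = v / (real t + w) powr p" for t by (simp add: alpha)
      have "\<mu> * \<alpha> 0 \<le> \<mu> * (2 / (L + \<mu>))"
        using alpha0 mu by (intro mult_left_mono) auto
      also have "\<dots> \<le> 2" using L mu by (simp add: field_simps)
      finally show "\<mu> * \<alpha> 0 \<le> 2" .
    qed
  next
    fix t :: nat
    assume p1: "p = 1" and b: "\<mu> * v / 2 > 1" and t: "real t + w - 1 > 0"
    have \<alpha>1: "\<alpha> s = v / (real s + w)" for s
      using pos[of s] by (simp add: alpha p1)
    have "A t \<le> (w / (real t + w)) powr (\<mu> * v / 2) * A 0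
        + ((w + 1) / w)\<^sup>2 / (\<mu> * v / 2 - 1) * ((w + 1) / w) powr (\<mu> * v / 2) * (K * v\<^sup>2 / (real t + w - 1))"
      by (rule harmonic_stepsize_rate[where A = A and t = t, OF A0 vw K0 b step[unfolded \<alpha>1] t])
    moreover have "\<rho>\<^sub>1 = ((w + 1) / w)\<^sup>2"
      using vw by (simp add: rho1 p1 powr_numeral)
    ultimately show "A t \<le> (w / (real t + w)) powr (\<mu> * v / 2) * A 0
        + \<rho>\<^sub>1 / (\<mu> * v / 2 - 1) * ((w + 1) / w) powr (\<mu> * v / 2) * (K * v\<^sup>2 / (real t + w - 1))"
      by simp
  qed
qed

end
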